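(* Assume that the digraph $\bar{\mathcal{G}}$ contains a directed spanning tree with node $v_0$ as its root, and consider the dynamic compensator $$\dot{\eta}_{i,l}=A\eta_{i,l}-KC(\eta_{i,l}-\eta_{i,l+1}),\quad l=1,\dots,r_i,$$ $$\dot{\eta}_{i,r_i+1}=A\eta_{i,r_i+1}-KC\sum_{j=0}^N a_{ij}(\eta_{i,r_i+1}-\eta_{i,1})-K\sum_{j=0}^N a_{ij}(y_i-y_j),\qquad \hat y_i=C\eta_{i,1},\qquad i=1,\dots,N,$$ with gain $K=\mu P_0C^T$, where $P_0$ and $\mu$ are as specified in the context. Put $\hat e_{i,1}=y_i-\hat y_i$, $\hat e=[\hat e_{1,1},\dots,\hat e_{N,1}]^T$, and $\bar\eta_{i,l}=\eta_{i,l}-x_0$ for $i=1,\dots,N$, $l=1,\dots,r_i+1$. Then there exist a $\mathcal{KL}$-function $\beta$ and a $\mathcal{K}$-function $\gamma$ such that for all $i=1,\dots,N$ and $l=1,\dots,r_i+1$, $$\|\bar\eta_{i,l}(t)\|\le \beta(\|\bar\eta_{i,l}(0)\|,t)+\gamma(\|\hat e\|_\infty),\qquad t\ge 0.$$ In particular, if $\lim_{t\to\infty}\hat e_{i,1}(t)=0$ for all $i=1,\dots,N$, then $\lim_{t\to\infty}\bar\eta_{i,l}(t)=0$ for all $i=1,\dots,N$, $l=1,\dots,r_i+1$.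
   Context: Followers. There are $N$ subsystems with (possibly different) orders $r_i\ge 1$: $$\dot x_{i,l}=x_{i,l+1}+\psi_{i,l}(x_{i,1},\dots,x_{i,l})^T\theta_i,\ l=1,\dots,r_i-1,\qquad \dot x_{i,r_i}=u_i+\psi_{i,r_i}(x_{i,1},\dots,x_{i,r_i})^T\theta_i,\qquad y_i=x_{i,1},$$ $i=1,\dots,N$, with state $x_i=[x_{i,1},\dots,x_{i,r_i}]^T\in\mathbb{R}^{r_i}$, input $u_i\in\mathbb{R}$, output $y_i\in\mathbb{R}$, unknown constant vector $\theta_i\in\mathbb{R}^{m_i}$, and known smooth functions $\psi_{i,l}:\mathbb{R}^l\to\mathbb{R}^{m_i}$. In the claim the $y_i$, $i=1,\dots,N$, are the outputs of these subsystems. Leader. $\dot x_0=Ax_0$, $y_0=Cx_0$, with $x_0\in\mathbb{R}^\nu$, $A\in\mathbb{R}^{\nu\times\nu}$, $C\in\mathbb{R}^{1\times\nu}$. Standing assumption: $(A,C)$ is detectable. Graph. $\bar{\mathcal{G}}=\{\bar{\mathcal V},\bar{\mathcal E}\}$ is a digraph with nodes $\bar{\mathcal V}=\{v_0,v_1,\dots,v_N\}$ ($v_0$ the leader, $v_i$ the $i$th subsystem), and weighted adjacency matrix $[a_{ij}]_{i,j=0}^N$ with nonnegative entries, $a_{ii}=0$, and, for $i=1,\dots,N$, $j=0,\dots,N$, $a_{ij}>0$ if and only if $(v_j,v_i)\in\bar{\mathcal E}$ (an edge from $v_j$ to $v_i$). Compensator states are $\eta_{i,l}\in\mathbb{R}^\nu$,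 and $K\in\mathbb{R}^{\nu\times 1}$. Gain design. Let $\hat{\mathcal H}=\hat{\mathcal L}+\hat\Delta$, a square matrix of size $\sum_{i=1}^N(r_i+1)$, where $\hat{\mathcal L}=[\hat L_{ij}]_{i,j=1}^N$ is the block matrix such that: $\hat L_{ii}\in\mathbb{R}^{(r_i+1)\times(r_i+1)}$ has $1$ in diagonal positions $1,\dots,r_i$, $-1$ in positions $(l,l+1)$ for $l=1,\dots,r_i$, $\sum_{j=1}^N a_{ij}$ in position $(r_i+1,r_i+1)$, and zeros elsewhere; for $i\ne j$, $\hat L_{ij}\in\mathbb{R}^{(r_i+1)\times(r_j+1)}$ has $-a_{ij}$ in position $(r_i+1,1)$ and zeros elsewhere; and $\hat\Delta=\mathrm{diag}\{\hat\Delta_1,\dots,\hat\Delta_N\}$ with $\hat\Delta_i=\mathrm{diag}\{0,\dots,0,a_{i0}\}\in\mathbb{R}^{(r_i+1)\times(r_i+1)}$. Under the spanning tree assumption all eigenvalues of $\hat{\mathcal H}$ have positive real parts; $\lambda_1(\hat{\mathcal H})$ denotes the eigenvalue of $\hat{\mathcal H}$ with the smallest real part. $P_0=P_0^T>0$ is the unique positive definite solution of $AP_0+P_0A^T+I_\nu-P_0C^TCP_0=0$, and $\mu\ge 1/\mathrm{Re}\{\lambda_1(\hat{\mathcal H})\}$. Notation. $\|\cdot\|$ is the Euclidean norm; $\|\cdot\|_\infty$ is the essential supremum norm of a vector function of time. $\mathbb{R}^+$ denotes the nonnegative reals. A function $\gamma:\mathbb{R}^+\to\mathbb{R}^+$ is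 a $\mathcal{K}$-function if it is continuous, strictly increasing, and $\gamma(0)=0$. A function $\beta:\mathbb{R}^+\times\mathbb{R}^+\to\mathbb{R}$ is a $\mathcal{KL}$-function if $\beta(\cdot,t)$ is a $\mathcal{K}$-function for each fixed $t>0$ and $\beta(s,t)\to 0$ decreasingly as $t\to\infty$ for each fixed $s>0$.
   Formalization: The first argument of β is the Euclidean norm of all initial errors η̄_{j,k}(0) stacked together, not ‖η̄_{i,l}(0)‖ of the single block; the printed bound fails because the blocks are coupled (a block starting at 0 is driven by the others even if ê=0). *)

theory Defs
  imports
    "HOL-Analysis.Analysis"
    "HOL-Probability.Essential_Supremum"
    "Jordan_Normal_Form.Char_Poly"
begin

text \<open>
  Nodes and subsystems are numbered by natural numbers: \<open>0\<close> is the leader and \<open>1, \<dots>, N\<close> are the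
  followers. Vectors and matrices of the leader's dimension \<open>\<nu>\<close> are indexed by a finite type; the
  matrix \<open>Hhat\<close> below, whose size depends on the orders \<open>r i\<close>, is a matrix with explicit dimensions.
  Signals are functions on \<open>real\<close> of which only the values at \<open>t \<ge> 0\<close> matter.
\<close>

subsection \<open>Comparison functions\<close>

definition class_K :: "(real \<Rightarrow> real) \<Rightarrow> bool" where
  "class_K \<gamma> \<longleftrightarrow> continuous_on {0..} \<gamma> \<and> strict_mono_on {0..} \<gamma> \<and> \<gamma> 0 = 0"

definition class_KL :: "(real \<Rightarrow> real \<Rightarrow> real) \<Rightarrow> bool" where
  "class_KL \<beta> \<longleftrightarrow>
     (\<forall>t>0. class_K (\<lambda>s. \<beta> s t)) \<and>
     (\<forall>s>0. antimono_on {0..} (\<beta> s) \<and> (\<beta> s \<longlongrightarrow> 0) at_top)"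

subsection \<open>The communication graph\<close>

text \<open>\<open>(j, i) \<in> E\<close> is an edge from node \<open>j\<close> to node \<open>i\<close>; its weight is \<open>a i j\<close>.\<close>

definition weighted_digraph :: "nat \<Rightarrow> (nat \<times> nat) set \<Rightarrow> (nat \<Rightarrow> nat \<Rightarrow> real) \<Rightarrow> bool" where
  "weighted_digraph N E a \<longleftrightarrow>
     E \<subseteq> {0..N} \<times> {0..N} \<and>
     (\<forall>i\<in>{0..N}. \<forall>j\<in>{0..N}. 0 \<le> a i j) \<and>
     (\<forall>i\<in>{0..N}. a i i = 0) \<and>
     (\<forall>i\<in>{1..N}. \<forall>j\<in>{0..N}. 0 < a i j \<longleftrightarrow> (j, i) \<in> E)"

text \<open>
  A directed tree: the root has no parent, every other node has exactly one parent, and there is a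
  directed path from the root to every node. It spans the digraph if it contains all of its nodes.
\<close>

definition directed_tree :: "'v set \<Rightarrow> ('v \<times> 'v) set \<Rightarrow> 'v \<Rightarrow> bool" where
  "directed_tree V T v0 \<longleftrightarrow>
     v0 \<in> V \<and> T \<subseteq> V \<times> V \<and>
     (\<forall>w. (w, v0) \<notin> T) \<and>
     (\<forall>v\<in>V - {v0}. \<exists>!w. (w, v) \<in> T) \<and>
     (\<forall>v\<in>V. (v0, v) \<in> T\<^sup>*)"

definition has_spanning_tree :: "'v set \<Rightarrow> ('v \<times> 'v) set \<Rightarrow> 'v \<Rightarrow> bool" where
  "has_spanning_tree V E v0 \<longleftrightarrow> (\<exists>T\<subseteq>E. directed_tree V T v0)"

subsection \<open>The matrix of the gain design\<close>

text \<open>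
  The rows and columns of \<open>Hhat\<close> are labelled by the pairs \<open>(i, l)\<close> with \<open>1 \<le> i \<le> N\<close> and
  \<open>1 \<le> l \<le> r i + 1\<close>, in lexicographic order; \<open>i\<close> is the block and \<open>l\<close> the position in the block.
\<close>

definition block_index :: "nat \<Rightarrow> (nat \<Rightarrow> nat) \<Rightarrow> (nat \<times> nat) list" where
  "block_index N r = concat (map (\<lambda>i. map (Pair i) [1..<r i + 2]) [1..<N + 1])"

definition block_mat :: "nat \<Rightarrow> (nat \<Rightarrow> nat) \<Rightarrow> (nat \<Rightarrow> nat \<Rightarrow> nat \<Rightarrow> nat \<Rightarrow> real) \<Rightarrow> real Matrix.mat" where
  "block_mat N r B =
     (let ix = block_index N r; d = length ix
      in Matrix.mat d d (\<lambda>(p, q). B (fst (ix ! p)) (fst (ix ! q)) (snd (ix ! p)) (snd (ix ! q))))"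

text \<open>\<open>Lhat_block N r a i j k l\<close> is the entry of the block \<open>(i, j)\<close> in position \<open>(k, l)\<close>.\<close>

definition Lhat_block ::
    "nat \<Rightarrow> (nat \<Rightarrow> nat) \<Rightarrow> (nat \<Rightarrow> nat \<Rightarrow> real) \<Rightarrow> nat \<Rightarrow> nat \<Rightarrow> nat \<Rightarrow> nat \<Rightarrow> real" where
  "Lhat_block N r a i j k l =
     (if i = j then
        (if k \<in> {1..r i} \<and> l = k then 1
         else if k \<in> {1..r i} \<and> l = k + 1 then - 1
         else if k = r i + 1 \<and> l = r i + 1 then (\<Sum>j=1..N. a i j)
         else 0)
      else (if k = r i + 1 \<and> l = 1 then - a i j else 0))"

definition Delta_block ::
    "(nat \<Rightarrow> nat) \<Rightarrow> (nat \<Rightarrow> nat \<Rightarrow> real) \<Rightarrow> nat \<Rightarrow> nat \<Rightarrow> nat \<Rightarrow> nat \<Rightarrow> real" where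
  "Delta_block r a i j k l = (if i = j \<and> k = r i + 1 \<and> l = r i + 1 then a i 0 else 0)"

definition Hhat :: "nat \<Rightarrow> (nat \<Rightarrow> nat) \<Rightarrow> (nat \<Rightarrow> nat \<Rightarrow> real) \<Rightarrow> real Matrix.mat" where
  "Hhat N r a = block_mat N r (Lhat_block N r a) + block_mat N r (Delta_block r a)"

text \<open>
  The eigenvalue with the smallest real part is unique only up to complex conjugation and further
  eigenvalues with the same real part, hence a predicate.
\<close>

definition smallest_Re_eigenvalue :: "real Matrix.mat \<Rightarrow> complex \<Rightarrow> bool" where
  "smallest_Re_eigenvalue H \<sigma> \<longleftrightarrow> is_arg_min Re (eigenvalue (map_mat complex_of_real H)) \<sigma>"

subsection \<open>Detectability and the Riccati equation\<close>

definition hurwitz :: "real^'n^'n \<Rightarrow> bool" where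
  "hurwitz M \<longleftrightarrow>
     (\<forall>\<sigma> v. v \<noteq> 0 \<and> map_matrix complex_of_real M *v v = \<sigma> *s v \<longrightarrow> Re \<sigma> < 0)"

definition detectable :: "real^'n^'n \<Rightarrow> real^'n^1 \<Rightarrow> bool" where
  "detectable A C \<longleftrightarrow> (\<exists>F :: real^1^'n. hurwitz (A - F ** C))"

definition sym_pos_def :: "real^'n^'n \<Rightarrow> bool" where
  "sym_pos_def P \<longleftrightarrow>
     Finite_Cartesian_Product.transpose P = P \<and> (\<forall>v. v \<noteq> 0 \<longrightarrow> 0 < inner v (P *v v))"

definition riccati :: "real^'n^'n \<Rightarrow> real^'n^1 \<Rightarrow> real^'n^'n \<Rightarrow> bool" where
  "riccati A C P \<longleftrightarrow>
     A ** P + P ** Finite_Cartesian_Product.transpose A + Finite_Cartesian_Product.mat 1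
       - P ** Finite_Cartesian_Product.transpose C ** C ** P = 0"

subsection \<open>Followers, leader and compensator\<close>

text \<open>
  A function on \<open>\<real>\<^sup>l\<close> is encoded as a function of \<open>z :: nat \<Rightarrow> real\<close> that depends only on the
  coordinates \<open>z 1, \<dots>, z l\<close>; continuity with respect to the product topology is then continuity on
  \<open>\<real>\<^sup>l\<close>. \<open>Ck l k f\<close> means that all partial derivatives up to order \<open>k\<close> exist and are continuous.
\<close>

primrec Ck :: "nat \<Rightarrow> nat \<Rightarrow> ((nat \<Rightarrow> real) \<Rightarrow> real) \<Rightarrow> bool" where
  "Ck l 0 f \<longleftrightarrow> continuous_on UNIV f"
| "Ck l (Suc k) f \<longleftrightarrow> continuous_on UNIV f \<and>
     (\<forall>s\<in>{1..l}. \<exists>g. Ck l k g \<and> (\<forall>z. ((\<lambda>w. f (z(s := w))) has_real_derivative g z) (at (z s))))"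

definition smooth_on_Rl :: "nat \<Rightarrow> ((nat \<Rightarrow> real) \<Rightarrow> real) \<Rightarrow> bool" where
  "smooth_on_Rl l f \<longleftrightarrow>
     (\<forall>z z'. (\<forall>s\<in>{1..l}. z s = z' s) \<longrightarrow> f z = f z') \<and> (\<forall>k. Ck l k f)"

text \<open>
  \<open>x i l\<close> is the \<open>l\<close>-th state component of subsystem \<open>i\<close>; the parameter \<open>\<theta> i\<close> and the values of
  \<open>\<psi> i l\<close> are vectors with components \<open>1, \<dots>, m i\<close>.
\<close>

definition follower_solution ::
    "nat \<Rightarrow> (nat \<Rightarrow> nat) \<Rightarrow> (nat \<Rightarrow> nat) \<Rightarrow> (nat \<Rightarrow> nat \<Rightarrow> (nat \<Rightarrow> real) \<Rightarrow> nat \<Rightarrow> real) \<Rightarrow>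
     (nat \<Rightarrow> nat \<Rightarrow> real) \<Rightarrow> (nat \<Rightarrow> real \<Rightarrow> real) \<Rightarrow> (nat \<Rightarrow> nat \<Rightarrow> real \<Rightarrow> real) \<Rightarrow> bool" where
  "follower_solution N r m \<psi> \<theta> u x \<longleftrightarrow>
     (\<forall>i\<in>{1..N}. \<forall>t\<ge>0.
        (\<forall>l\<in>{1..<r i}.
           (x i l has_real_derivative
              x i (l + 1) t + (\<Sum>k=1..m i. \<psi> i l (\<lambda>s. x i s t) k * \<theta> i k)) (at t within {0..})) \<and>
        (x i (r i) has_real_derivative
           u i t + (\<Sum>k=1..m i. \<psi> i (r i) (\<lambda>s. x i s t) k * \<theta> i k)) (at t within {0..}))"

definition leader_solution :: "real^'n^'n \<Rightarrow> (real \<Rightarrow> real^'n) \<Rightarrow> bool" where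
  "leader_solution A x0 \<longleftrightarrow> (\<forall>t\<ge>0. (x0 has_vector_derivative A *v x0 t) (at t within {0..}))"

definition outp :: "real^'n^1 \<Rightarrow> (real \<Rightarrow> real^'n) \<Rightarrow> (nat \<Rightarrow> nat \<Rightarrow> real \<Rightarrow> real) \<Rightarrow> nat \<Rightarrow> real \<Rightarrow> real"
  where "outp C x0 x i t = (if i = 0 then (C *v x0 t) $ 1 else x i 1 t)"

definition compensator_solution ::
    "nat \<Rightarrow> (nat \<Rightarrow> nat) \<Rightarrow> (nat \<Rightarrow> nat \<Rightarrow> real) \<Rightarrow> real^'n^'n \<Rightarrow> real^'n^1 \<Rightarrow> real^1^'n \<Rightarrow>
     (nat \<Rightarrow> real \<Rightarrow> real) \<Rightarrow> (nat \<Rightarrow> nat \<Rightarrow> real \<Rightarrow> real^'n) \<Rightarrow> bool" where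
  "compensator_solution N r a A C K y \<eta> \<longleftrightarrow>
     (\<forall>i\<in>{1..N}. \<forall>t\<ge>0.
        (\<forall>l\<in>{1..r i}.
           (\<eta> i l has_vector_derivative
              A *v \<eta> i l t - K *v (C *v (\<eta> i l t - \<eta> i (l + 1) t))) (at t within {0..})) \<and>
        (\<eta> i (r i + 1) has_vector_derivative
           A *v \<eta> i (r i + 1) t
           - K *v (C *v (\<Sum>j=0..N. a i j *\<^sub>R (\<eta> i (r i + 1) t - \<eta> i 1 t)))
           - K *v Finite_Cartesian_Product.vec (\<Sum>j=0..N. a i j * (y i t - y j t)))
          (at t within {0..}))"

subsection \<open>Errors and their norms\<close>

definition ehat ::
    "real^'n^1 \<Rightarrow> (nat \<Rightarrow> nat \<Rightarrow> real \<Rightarrow> real) \<Rightarrow> (nat \<Rightarrow> nat \<Rightarrow> real \<Rightarrow> real^'n) \<Rightarrow> nat \<Rightarrow> real \<Rightarrow> real" where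
  "ehat C x \<eta> i t = x i 1 t - (C *v \<eta> i 1 t) $ 1"

definition etabar ::
    "(real \<Rightarrow> real^'n) \<Rightarrow> (nat \<Rightarrow> nat \<Rightarrow> real \<Rightarrow> real^'n) \<Rightarrow> nat \<Rightarrow> nat \<Rightarrow> real \<Rightarrow> real^'n" where
  "etabar x0 \<eta> i l t = \<eta> i l t - x0 t"

text \<open>
  The blocks of the error system are coupled: an error block that starts at \<open>0\<close> is in general driven
  away from \<open>0\<close> by the other blocks even if \<open>ehat\<close> vanishes. An estimate in terms of the initial
  error therefore has to use the Euclidean norm of the stacked initial error.
\<close>

definition stacked_norm :: "nat \<Rightarrow> (nat \<Rightarrow> nat) \<Rightarrow> (nat \<Rightarrow> nat \<Rightarrow> 'a::real_normed_vector) \<Rightarrow> real" where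
  "stacked_norm N r \<xi> = L2_set (\<lambda>(i, l). norm (\<xi> i l)) (SIGMA i:{1..N}. {1..r i + 1})"

text \<open>The essential supremum over \<open>t \<ge> 0\<close> of the Euclidean norm in \<open>\<real>\<^sup>N\<close>; it may be infinite.\<close>

definition Linf_norm :: "nat \<Rightarrow> (nat \<Rightarrow> real \<Rightarrow> real) \<Rightarrow> ereal" where
  "Linf_norm N e = esssup (lebesgue_on {0..}) (\<lambda>t. ereal (L2_set (\<lambda>i. e i t) {1..N}))"

end

theory Submission
  imports Defs "Jordan_Normal_Form.Schur_Decomposition" "HOL-Real_Asymp.Real_Asymp"
begin

text \<open>
Write \<open>\<zeta>\<^sub>p\<close> for the compensator errors \<open>etabar\<close>, listed in the order of the rows of \<open>H = Hhat N r a\<close>.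
Substituting \<open>y\<^sub>i = C \<eta>\<^sub>i\<^sub>1 + e\<^sub>i\<close> with \<open>e = ehat\<close> turns the compensator into the linear network
\<open>\<zeta>\<^sub>p' = A \<zeta>\<^sub>p - K C (\<Sum>q. H\<^sub>p\<^sub>q \<zeta>\<^sub>q) - K w\<^sub>p\<close>, whose inputs \<open>w\<^sub>p\<close> are fixed linear combinations of
the \<open>e\<^sub>j\<close> (lemmas \<open>compensator_error_equation\<close> and \<open>Hhat_row\<close>). The claim is
input-to-state stability of this network.

The textbook argument triangularizes \<open>H\<close> and treats the resulting cascade of systems
\<open>A - \<lambda> \<mu> P0 C\<^sup>T C\<close>. Here the cascade is replaced by a single quadratic storage function. A
Schur triangularization of \<open>H\<close>, rescaled so that the off-diagonal part is small, gives real
coordinates \<open>s\<close> in which \<open>H\<close> is dissipative with any rate below the least real part of an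
eigenvalue: \<open>\<Sum>k. (s v)\<^sub>k (s H v)\<^sub>k \<ge> \<alpha> \<Sum>k. (s v)\<^sub>k\<^sup>2\<close> (lemma \<open>dissipative_coordinates\<close>). As
\<open>\<mu> Re \<sigma> \<ge> 1\<close>, the rate \<open>\<alpha> = 3 / (4 \<mu>)\<close> is admissible. With \<open>\<xi>\<^sub>k = (s \<zeta>)\<^sub>k\<close> and
\<open>V = \<Sum>k. \<xi>\<^sub>k \<bullet> P0\<^sup>-\<^sup>1 \<xi>\<^sub>k\<close>, the Riccati equation turns the drift \<open>A\<close> into
\<open>- |P0\<^sup>-\<^sup>1 \<xi>\<^sub>k|\<^sup>2 + (C \<xi>\<^sub>k)\<^sup>2\<close>, whereas the gain \<open>K = \<mu> P0 C\<^sup>T\<close> makes the coupling act on the scalars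
\<open>C \<zeta>\<^sub>p\<close> only. Dissipativity of \<open>H\<close> on these scalars contributes at most \<open>- (3/2) \<Sum>k. (C \<xi>\<^sub>k)\<^sup>2\<close>, which
absorbs the positive term and leaves enough to dominate the input:
\<open>V' \<le> - \<kappa> V + c |w|\<^sup>2\<close> (lemma \<open>coupled_storage_function\<close>). A comparison argument gives the
estimate with an exponential \<open>\<beta>\<close> and a linear \<open>\<gamma>\<close>, and the convergence claim.

Two further facts are needed. The eigenvalues of \<open>H\<close> have positive real part, so that \<open>\<mu> > 0\<close>: this
is Gershgorin's theorem, sharpened by the spanning tree (lemma \<open>Hhat_eigenvalue_Re_pos\<close>). And \<open>e\<close> is
continuous, so its essential supremum bounds it at every time (lemma \<open>ehat_norm_le_Linf_norm\<close>).
\<close>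

section \<open>Eigenvalues of the coupling matrix\<close>

lemma set_block_index: "set (block_index N r) = (SIGMA i:{1..N}. {1..r i + 1})"
  by (auto simp: block_index_def image_iff simp del: upt_Suc)

lemma distinct_block_index: "distinct (block_index N r)"
proof -
  have "distinct (concat (map (\<lambda>i. map (Pair i) [1..<r i + 2]) js))" if "distinct js" for js
    using that by (induction js) (auto simp: distinct_map inj_on_def simp del: upt_Suc)
  then show ?thesis by (simp add: block_index_def del: upt_Suc)
qed

lemma sum_block_index:
  "(\<Sum>q<length (block_index N r). f (block_index N r ! q)) = (\<Sum>(j, l)\<in>(SIGMA i:{1..N}. {1..r i + 1}). f (j, l))"
  using sum.reindex_bij_betw[OF bij_betw_nth[OF distinct_block_index refl refl], of f N r]
  by (simp add: set_block_index)

definition in_weight :: "nat \<Rightarrow> (nat \<Rightarrow> nat \<Rightarrow> real) \<Rightarrow> nat \<Rightarrow> real" where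
  "in_weight N a i = (\<Sum>j=0..N. a i j)"

text \<open>
The row of a block's last position compares \<open>f (i, r i + 1)\<close> with the first entries of the
neighbouring blocks; the leader's weight \<open>a i 0\<close> occurs only in the diagonal entry, which is therefore
the full in-weight. Both the eigenvector argument and the error system read the matrix in this
form, the former with complex numbers and the latter with vectors for \<open>f\<close>.
\<close>

lemma Hhat_row:
  fixes N r a and f :: "nat \<times> nat \<Rightarrow> 'a::real_vector"
  defines "ix \<equiv> block_index N r"
  assumes p: "p < length ix" and ip: "ix ! p = (i, k)" and ai: "a i i = 0"
  shows "(\<Sum>q<length ix. Hhat N r a $$ (p, q) *\<^sub>R f (ix ! q)) =
    (if k \<le> r i then f (i, k) - f (i, k + 1)
     else in_weight N a i *\<^sub>R f (i, r i + 1) - (\<Sum>j=1..N. a i j *\<^sub>R f (j, 1)))"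
proof -
  have "(i, k) \<in> set ix" using p ip by (metis nth_mem)
  then have i: "i \<in> {1..N}" and k: "k \<in> {1..r i + 1}" by (auto simp: ix_def set_block_index)
  define B where "B j l = Lhat_block N r a i j k l + Delta_block r a i j k l" for j l
  have "(\<Sum>q<length ix. Hhat N r a $$ (p, q) *\<^sub>R f (ix ! q))
      = (\<Sum>q<length ix. (\<lambda>(j, l). B j l *\<^sub>R f (j, l)) (ix ! q))"
    using p ip unfolding Hhat_def block_mat_def ix_def B_def
    by (intro sum.cong) (auto simp: Let_def split: prod.split)
  also have "\<dots> = (\<Sum>(j, l)\<in>(SIGMA i:{1..N}. {1..r i + 1}). B j l *\<^sub>R f (j, l))"
    unfolding ix_def sum_block_index by simp
  also have "\<dots> = (\<Sum>j=1..N. \<Sum>l=1..r j + 1. B j l *\<^sub>R f (j, l))"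
    by (rule sum.Sigma[symmetric]) auto
  also have "\<dots> = (\<Sum>l=1..r i + 1. B i l *\<^sub>R f (i, l))
      + (\<Sum>j\<in>{1..N} - {i}. \<Sum>l=1..r j + 1. B j l *\<^sub>R f (j, l))"
    using i by (simp add: sum.remove)
  also have "(\<Sum>l=1..r i + 1. B i l *\<^sub>R f (i, l)) =
     (if k \<le> r i then f (i, k) - f (i, k + 1) else in_weight N a i *\<^sub>R f (i, r i + 1))"
  proof (cases "k \<le> r i")
    case True
    have "(\<Sum>l=1..r i + 1. B i l *\<^sub>R f (i, l)) =
      (\<Sum>l=1..r i + 1. (if l = k then f (i, l) else 0) - (if l = k + 1 then f (i, l) else 0))"
      using True k by (intro sum.cong) (auto simp: B_def Lhat_block_def Delta_block_def)
    then show ?thesis using True k by (simp add: sum_subtractf del: sum.cl_ivl_Suc)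
  next
    case False
    then have "k = r i + 1" using k by simp
    then have "(\<Sum>l=1..r i + 1. B i l *\<^sub>R f (i, l)) =
      (\<Sum>l=1..r i + 1. if l = r i + 1 then in_weight N a i *\<^sub>R f (i, l) else 0)"
      by (intro sum.cong)
        (auto simp: B_def Lhat_block_def Delta_block_def in_weight_def sum.atLeast_Suc_atMost)
    then show ?thesis using False by (simp del: sum.cl_ivl_Suc)
  qed
  also have "(\<Sum>j\<in>{1..N} - {i}. \<Sum>l=1..r j + 1. B j l *\<^sub>R f (j, l)) =
     (if k \<le> r i then 0 else - (\<Sum>j=1..N. a i j *\<^sub>R f (j, 1)))"
  proof (cases "k \<le> r i")
    case True
    then show ?thesis by (auto simp: B_def Lhat_block_def Delta_block_def intro!: sum.neutral)
  next
    case False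
    then have k: "k = r i + 1" using k by simp
    have "(\<Sum>l=1..r j + 1. B j l *\<^sub>R f (j, l)) = - a i j *\<^sub>R f (j, 1)" if "j \<noteq> i" for j
    proof -
      have "(\<Sum>l=1..r j + 1. B j l *\<^sub>R f (j, l)) = (\<Sum>l=1..r j + 1. if l = 1 then - a i j *\<^sub>R f (j, l) else 0)"
        using that k by (intro sum.cong) (auto simp: B_def Lhat_block_def Delta_block_def)
      then show ?thesis by (simp del: sum.cl_ivl_Suc)
    qed
    then have "(\<Sum>j\<in>{1..N} - {i}. \<Sum>l=1..r j + 1. B j l *\<^sub>R f (j, l)) = (\<Sum>j\<in>{1..N} - {i}. - a i j *\<^sub>R f (j, 1))"
      by (intro sum.cong) auto
    also have "\<dots> = - (\<Sum>j=1..N. a i j *\<^sub>R f (j, 1))"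
      using i ai by (simp add: sum.remove[where x = i] sum_negf)
    finally show ?thesis using False by simp
  qed
  finally show ?thesis by auto
qed

lemma Hhat_carrier: "Hhat N r a \<in> carrier_mat (length (block_index N r)) (length (block_index N r))"
  by (simp add: Hhat_def block_mat_def Let_def)

text \<open>
The step in Gershgorin's theorem: in a row with diagonal entry \<open>c\<close> in which the eigenvector has its
maximal modulus \<open>M\<close>, the distance from \<open>c\<close> to an eigenvalue \<open>e\<close> of the closed left half-plane is at
least \<open>c\<close>, so the other entries have to balance all of \<open>c\<close>.
\<close>

lemma dominant_row_weight_le:
  fixes z :: complex
  assumes "Re e \<le> 0" "norm y \<le> D * M" "norm z = M" "0 < M" and row: "of_real c * z - y = e * z"
  shows "c \<le> D"
proof -
  have "c * M \<le> (c - Re e) * M" using assms by (intro mult_right_mono) auto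
  also have "\<dots> \<le> norm (of_real c - e) * M"
    using complex_Re_le_cmod[of "of_real c - e"] assms by (intro mult_right_mono) auto
  also have "\<dots> = norm ((of_real c - e) * z)" using assms by (simp add: norm_mult)
  also have "(of_real c - e) * z = y" using row by (simp add: algebra_simps)
  finally have "c * M \<le> D * M" using assms by linarith
  then show ?thesis using assms by (metis mult_right_le_imp_le)
qed

text \<open>
Suppose \<open>Re e \<le> 0\<close> for an eigenvector \<open>f\<close>. Every row is weakly diagonally dominant, so at a
position where \<open>|f|\<close> is maximal the balance is exact: all positions to which the row is coupled are
maximal too, and the row has no weight towards the leader. Maximality thus spreads along each
block and then, through its first position, to all in-neighbours. Following the path from the root
of the spanning tree backwards, it reaches a node with the leader as in-neighbour, a contradiction.
\<close>

lemma Hhat_eigenvalue_Re_pos: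
  assumes G: "weighted_digraph N E a" and T: "has_spanning_tree {0..N} E 0"
    and ev: "eigenvalue (map_mat complex_of_real (Hhat N r a)) e"
  shows "0 < Re e"
proof (rule ccontr)
  assume "\<not> 0 < Re e"
  then have re: "Re e \<le> 0" by simp
  define ix where "ix = block_index N r"
  define d where "d = length ix"
  have Hd: "Hhat N r a \<in> carrier_mat d d" using Hhat_carrier by (simp add: d_def ix_def)
  from ev obtain v where "eigenvector (map_mat complex_of_real (Hhat N r a)) v e"
    by (auto simp: eigenvalue_def)
  then have v: "v \<in> carrier_vec d" and v0: "v \<noteq> 0\<^sub>v d"
    and Hv: "map_mat complex_of_real (Hhat N r a) *\<^sub>v v = e \<cdot>\<^sub>v v"
    using Hd by (auto simp: eigenvector_def)
  have bij: "bij_betw (nth ix) {..<d} (set ix)"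
    unfolding d_def using distinct_block_index by (intro bij_betw_nth) (auto simp: ix_def)
  define f where "f = (\<lambda>x. vec_index v (inv_into {..<d} (nth ix) x))"
  have f: "f (ix ! p) = vec_index v p" if "p < d" for p
    using that bij by (simp add: f_def bij_betw_def)
  have row: "(if k \<le> r i then f (i, k) - f (i, k + 1)
     else in_weight N a i *\<^sub>R f (i, r i + 1) - (\<Sum>j=1..N. a i j *\<^sub>R f (j, 1))) = e * f (i, k)"
    if ik: "i \<in> {1..N}" "k \<in> {1..r i + 1}" for i k
  proof -
    have "(i, k) \<in> set ix" using ik by (auto simp: ix_def set_block_index)
    then obtain p where p: "p < d" "ix ! p = (i, k)" by (auto simp: in_set_conv_nth d_def)
    have "vec_index (map_mat complex_of_real (Hhat N r a) *\<^sub>v v) p = vec_index (e \<cdot>\<^sub>v v) p" by (simp add: Hv)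
    then have "(\<Sum>q<d. Hhat N r a $$ (p, q) *\<^sub>R f (ix ! q)) = e * f (i, k)"
      using p Hd v f[of p] by (simp add: scalar_prod_def lessThan_atLeast0 scaleR_conv_of_real f)
    moreover have "a i i = 0" using G ik by (auto simp: weighted_digraph_def)
    ultimately show ?thesis
      using Hhat_row[of p N r i k a f] p by (simp add: ix_def d_def)
  qed
  define I where "I = (SIGMA i:{1..N}. {1..r i + 1})"
  have setix: "set ix = I" by (simp add: ix_def set_block_index I_def)
  obtain p where p: "p < d" "vec_index v p \<noteq> 0" using v v0 by (auto simp: vec_eq_iff)
  have pI: "ix ! p \<in> I" using p setix by (metis d_def nth_mem)
  have finI: "finite I" using setix by (metis List.finite_set)
  \<comment> \<open>the maximal modulus of the entries of the eigenvector\<close>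
  define M where "M = Max ((norm \<circ> f) ` I)"
  have Mge: "norm (f x) \<le> M" if "x \<in> I" for x
    using that finI unfolding M_def by (intro Max_ge) auto
  have M0: "0 < M" using Mge[OF pI] p f[of p] by (smt (verit) zero_less_norm_iff)
  have "M \<in> (norm \<circ> f) ` I" unfolding M_def using finI pI by (intro Max_in) auto
  then obtain i0 k0 where i0: "i0 \<in> {1..N}" "k0 \<in> {1..r i0 + 1}" "norm (f (i0, k0)) = M"
    by (auto simp: I_def)
  have chain: "norm (f (i, r i + 1)) = M" if i: "i \<in> {1..N}" and k: "k \<in> {1..r i + 1}" "norm (f (i, k)) = M" for i k
  proof -
    have "k \<le> r i + 1" using k by simp
    then show ?thesis using k
    proof (induction rule: inc_induct)
      case base then show ?case by simp
    next
      case (step n)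
      have n: "n \<in> {1..r i + 1}" "n \<le> r i" using step by auto
      have "f (i, n) - f (i, Suc n) = e * f (i, n)" using row[OF i n(1)] n(2) by simp
      then have "1 \<le> norm (f (i, Suc n)) / M"
        using step.prems M0 re Mge[of "(i, Suc n)"] i n
        by (intro dominant_row_weight_le[where c = 1 and e = e and y = "f (i, Suc n)" and M = M and z = "f (i, n)"]) (auto simp: I_def)
      then have "norm (f (i, Suc n)) = M"
        using M0 Mge[of "(i, Suc n)"] i n by (auto simp: I_def field_simps)
      then show ?case using step n by auto
    qed
  qed
  have parent: "j \<noteq> 0 \<and> norm (f (j, 1)) = M" if i: "i \<in> {1..N}" and fi: "norm (f (i, r i + 1)) = M" and ji: "(j, i) \<in> E" for i j
  proof -
    have j: "j \<in> {0..N}" and aj: "0 < a i j" using G i ji by (auto simp: weighted_digraph_def)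
    have a0: "0 \<le> a i j" if "j \<in> {0..N}" for j using G i that by (auto simp: weighted_digraph_def)
    \<comment> \<open>in-weights of the followers, discounted where the entry is not maximal\<close>
    define D where "D = (\<Sum>j=1..N. a i j * (norm (f (j, 1)) / M))"
    have w: "in_weight N a i = a i 0 + (\<Sum>j=1..N. a i j)"
      by (simp add: in_weight_def sum.atLeast_Suc_atMost)
    have le: "a i j * (norm (f (j, 1)) / M) \<le> a i j" if "j \<in> {1..N}" for j
      using a0[of j] that Mge[of "(j, 1)"] M0 by (intro mult_left_le) (auto simp: I_def)
    have DN: "D \<le> (\<Sum>j=1..N. a i j)" unfolding D_def using le by (intro sum_mono)
    have "in_weight N a i *\<^sub>R f (i, r i + 1) - (\<Sum>j=1..N. a i j *\<^sub>R f (j, 1)) = e * f (i, r i + 1)"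
      using row[OF i, of "r i + 1"] by simp
    moreover have "norm (\<Sum>j=1..N. a i j *\<^sub>R f (j, 1)) \<le> D * M"
    proof -
      have "norm (\<Sum>j=1..N. a i j *\<^sub>R f (j, 1)) \<le> (\<Sum>j=1..N. norm (a i j *\<^sub>R f (j, 1)))" by (rule norm_sum)
      also have "\<dots> = (\<Sum>j=1..N. a i j * norm (f (j, 1)))" using a0 by (intro sum.cong) auto
      also have "\<dots> = D * M" using M0 by (simp add: D_def sum_distrib_right)
      finally show ?thesis .
    qed
    ultimately have "in_weight N a i \<le> D"
      using re fi M0
      by (intro dominant_row_weight_le[where c = "in_weight N a i" and e = e and y = "\<Sum>j=1..N. a i j *\<^sub>R f (j, 1)" and M = M and z = "f (i, r i + 1)"])
        (auto simp: scaleR_conv_of_real)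
    then have eq: "a i 0 = 0" "D = (\<Sum>j=1..N. a i j)" using DN w a0[of 0] by auto
    have "j \<noteq> 0" using eq(1) aj by (metis less_irrefl)
    then have j1: "j \<in> {1..N}" using j by auto
    have "a i j * (norm (f (j, 1)) / M) = a i j"
    proof (rule ccontr)
      assume "a i j * (norm (f (j, 1)) / M) \<noteq> a i j"
      then have "D < (\<Sum>j=1..N. a i j)" unfolding D_def
        using le j1 by (intro sum_strict_mono_ex1) (auto simp: less_le)
      then show False using eq by simp
    qed
    then show ?thesis using \<open>j \<noteq> 0\<close> aj M0 by (simp add: field_simps)
  qed
  obtain T where "T \<subseteq> E" "directed_tree {0..N} T 0" using T by (auto simp: has_spanning_tree_def)
  then have path: "(0, i) \<in> E\<^sup>*" if "i \<in> {0..N}" for i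
    using that rtrancl_mono[of T E] by (auto simp: directed_tree_def)
  have EV: "(j, i) \<in> E \<Longrightarrow> j \<in> {0..N} \<and> i \<in> {0..N}" for i j using G by (auto simp: weighted_digraph_def)
  have noM: "i \<in> {1..N} \<longrightarrow> norm (f (i, r i + 1)) \<noteq> M" if "(0, i) \<in> E\<^sup>*" for i
    using that
  proof (induction rule: rtrancl_induct)
    case base then show ?case by simp
  next
    case (step j i)
    show ?case
    proof (intro impI notI)
      assume i: "i \<in> {1..N}" "norm (f (i, r i + 1)) = M"
      have "j \<noteq> 0" "norm (f (j, 1)) = M" using parent[OF i step(2)] by auto
      moreover have "j \<in> {1..N}" using EV[OF step(2)] \<open>j \<noteq> 0\<close> by auto
      ultimately show False using step.IH chain[of j 1] by auto
    qed
  qed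
  show False using chain[OF i0] noM[OF path, of i0] i0 by auto
qed

section \<open>Coordinates in which the coupling matrix is dissipative\<close>

lemma mat_mult_entry:
  assumes "X \<in> carrier_mat n n" "Y \<in> carrier_mat n n" "i < n" "j < n"
  shows "(X * Y) $$ (i, j) = (\<Sum>k<n. X $$ (i, k) * Y $$ (k, j))"
  using assms by (auto simp: scalar_prod_def lessThan_atLeast0 intro!: sum.cong)

text \<open>
\<open>S H = J S\<close> with \<open>J\<close> upper triangular comes from the Schur decomposition; conjugating with
\<open>diag (1, \<epsilon>, \<epsilon>\<^sup>2, \<dots>)\<close> multiplies the entry \<open>(k, l)\<close> of \<open>J\<close> by \<open>\<epsilon>\<^sup>l\<^sup>-\<^sup>k\<close>, which keeps the
eigenvalues on the diagonal and makes everything above it as small as desired.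
\<close>

lemma triangularization_small_off_diagonal:
  fixes H :: "complex Matrix.mat" and \<delta> :: real
  assumes H: "H \<in> carrier_mat d d" and "0 < \<delta>"
  obtains S T J :: "nat \<Rightarrow> nat \<Rightarrow> complex" where
    "\<And>p q. p < d \<Longrightarrow> q < d \<Longrightarrow> (\<Sum>k<d. T p k * S k q) = (if p = q then 1 else 0)"
    "\<And>k q. k < d \<Longrightarrow> q < d \<Longrightarrow> (\<Sum>p<d. S k p * H $$ (p, q)) = (\<Sum>l<d. J k l * S l q)"
    "\<And>k. k < d \<Longrightarrow> eigenvalue H (J k k)"
    "\<And>k l. k < d \<Longrightarrow> l < d \<Longrightarrow> k \<noteq> l \<Longrightarrow> cmod (J k l) \<le> \<delta>"
proof -
  obtain es where es: "char_poly H = (\<Prod>e\<leftarrow>es. [:- e, 1:])"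
    using char_poly_factorized[OF H] by blast
  obtain B P Q where "schur_decomposition H es = (B, P, Q)"
    by (metis prod_cases3)
  note sd = schur_decomposition[OF H es this]
  note w = similar_mat_witD2[OF H conjunct1[OF sd]]
  have B: "B \<in> carrier_mat d d" and P: "P \<in> carrier_mat d d" and Q: "Q \<in> carrier_mat d d"
    and PQ: "P * Q = 1\<^sub>m d" and QP: "Q * P = 1\<^sub>m d" and HB: "H = P * B * Q"
    using w by auto
  have "Q * H = Q * (P * (B * Q))" using HB B P Q by simp
  also have "\<dots> = (Q * P) * (B * Q)" by (rule assoc_mult_mat[symmetric]) (use B P Q in auto)
  also have "\<dots> = B * Q" using QP B Q by simp
  finally have QH: "Q * H = B * Q" .
  define M where "M = 1 + (\<Sum>k<d. \<Sum>l<d. cmod (B $$ (k, l)))"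
  have M: "cmod (B $$ (k, l)) \<le> M" if "k < d" "l < d" for k l
  proof -
    have "cmod (B $$ (k, l)) \<le> (\<Sum>l<d. cmod (B $$ (k, l)))"
      using that by (intro member_le_sum) auto
    also have "\<dots> \<le> (\<Sum>k<d. \<Sum>l<d. cmod (B $$ (k, l)))"
      using that by (intro member_le_sum[where f = "\<lambda>k. \<Sum>l<d. cmod (B $$ (k, l))"]) (auto intro: sum_nonneg)
    finally show ?thesis by (simp add: M_def)
  qed
  have M1: "1 \<le> M" unfolding M_def by (simp add: sum_nonneg)
  \<comment> \<open>as \<open>\<epsilon> \<le> 1\<close>, the positions far from the diagonal are scaled at least as strongly as those next to it\<close>
  define \<epsilon> where "\<epsilon> = min 1 (\<delta> / M)"
  have e: "0 < \<epsilon>" "\<epsilon> \<le> 1" "\<epsilon> * M \<le> \<delta>"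
    using M1 \<open>0 < \<delta>\<close> by (auto simp: \<epsilon>_def min_def field_simps)
  define S where "S k p = Q $$ (k, p) / of_real \<epsilon> ^ k" for k p
  define T where "T p k = P $$ (p, k) * of_real \<epsilon> ^ k" for p k
  define J where "J k l = B $$ (k, l) * of_real \<epsilon> ^ l / of_real \<epsilon> ^ k" for k l
  show thesis
  proof
    fix p q assume "p < d" "q < d"
    then show "(\<Sum>k<d. T p k * S k q) = (if p = q then 1 else 0)"
      using mat_mult_entry[OF P Q, of p q] PQ e by (simp add: T_def S_def)
  next
    fix k q assume kq: "k < d" "q < d"
    have "(\<Sum>p<d. Q $$ (k, p) * H $$ (p, q)) = (\<Sum>l<d. B $$ (k, l) * Q $$ (l, q))"
      using mat_mult_entry[OF Q H kq] mat_mult_entry[OF B Q kq] QH by simp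
    then show "(\<Sum>p<d. S k p * H $$ (p, q)) = (\<Sum>l<d. J k l * S l q)"
      using e by (simp add: S_def J_def flip: sum_divide_distrib)
  next
    fix k assume k: "k < d"
    then have "B $$ (k, k) \<in> set es"
      using sd B by (auto simp: diag_mat_def)
    then have "poly (char_poly H) (B $$ (k, k)) = 0"
      unfolding es by (auto simp: poly_prod_list prod_list_zero_iff)
    then have "eigenvalue H (B $$ (k, k))" using eigenvalue_root_char_poly[OF H] by simp
    then show "eigenvalue H (J k k)" using e by (simp add: J_def)
  next
    fix k l assume kl: "k < d" "l < d" "k \<noteq> l"
    show "cmod (J k l) \<le> \<delta>"
    proof (cases "l < k")
      case True
      then have "B $$ (k, l) = 0" using sd B kl by auto
      then show ?thesis using \<open>0 < \<delta>\<close> by (simp add: J_def)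
    next
      case False
      then have l: "l = k + (l - k - 1) + 1" using kl by simp
      have "of_real \<epsilon> ^ l / of_real \<epsilon> ^ k = (of_real (\<epsilon> * \<epsilon> ^ (l - k - 1)) :: complex)"
        by (subst l) (use e in \<open>simp add: power_add\<close>)
      then have "cmod (J k l) = cmod (B $$ (k, l)) * (\<epsilon> * \<epsilon> ^ (l - k - 1))"
        using e by (simp add: J_def norm_mult norm_power flip: times_divide_eq_right)
      also have "\<dots> \<le> M * (\<epsilon> * 1)"
        using M[OF kl(1,2)] e M1 by (intro mult_mono) (auto simp: power_le_one)
      also have "\<dots> \<le> \<delta>" using e by (simp add: mult.commute)
      finally show ?thesis .
    qed
  qed
qed

text \<open>
In the coordinates \<open>\<xi> = S v\<close> the diagonal of the triangular form contributes at least
\<open>b \<Sum>k. |\<xi>\<^sub>k|\<^sup>2\<close>, and the off-diagonal entries, bounded by \<open>\<delta>\<close>, take away at most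
\<open>\<delta> d \<Sum>k. |\<xi>\<^sub>k|\<^sup>2\<close>; the gap between \<open>\<alpha>\<close> and \<open>b\<close> pays for this. The inner product is the real one on
the complex plane.
\<close>

lemma dissipative_complex_coordinates:
  fixes H :: "complex Matrix.mat" and \<alpha> b :: real
  assumes H: "H \<in> carrier_mat d d" and "\<alpha> < b"
    and ev: "\<And>e. eigenvalue H e \<Longrightarrow> b \<le> Re e"
  obtains S T :: "nat \<Rightarrow> nat \<Rightarrow> complex" where
    "\<And>p q. p < d \<Longrightarrow> q < d \<Longrightarrow> (\<Sum>k<d. T p k * S k q) = (if p = q then 1 else 0)"
    "\<And>v. \<alpha> * (\<Sum>k<d. (cmod (\<Sum>p<d. S k p * v p))\<^sup>2)
        \<le> (\<Sum>k<d. inner (\<Sum>p<d. S k p * v p) (\<Sum>p<d. S k p * (\<Sum>q<d. H $$ (p, q) * v q)))"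
proof -
  define \<delta> where "\<delta> = (b - \<alpha>) / (d + 1)"
  have \<delta>: "0 < \<delta>" "\<delta> * d \<le> b - \<alpha>" using \<open>\<alpha> < b\<close> by (auto simp: \<delta>_def field_simps)
  obtain S T J where TS: "\<And>p q. p < d \<Longrightarrow> q < d \<Longrightarrow> (\<Sum>k<d. T p k * S k q) = (if p = q then 1 else 0)"
    and SH: "\<And>k q. k < d \<Longrightarrow> q < d \<Longrightarrow> (\<Sum>p<d. S k p * H $$ (p, q)) = (\<Sum>l<d. J k l * S l q)"
    and Jd: "\<And>k. k < d \<Longrightarrow> eigenvalue H (J k k)"
    and Jo: "\<And>k l. k < d \<Longrightarrow> l < d \<Longrightarrow> k \<noteq> l \<Longrightarrow> cmod (J k l) \<le> \<delta>"
    by (rule triangularization_small_off_diagonal[OF H \<delta>(1)]) (rule that)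
  show thesis
  proof (rule that[OF TS])
    fix v
    define \<xi> where "\<xi> k = (\<Sum>p<d. S k p * v p)" for k
    define X where "X = (\<Sum>k<d. (cmod (\<xi> k))\<^sup>2)"
    have X0: "0 \<le> X" by (simp add: X_def sum_nonneg)
    have y: "(\<Sum>p<d. S k p * (\<Sum>q<d. H $$ (p, q) * v q)) = (\<Sum>l<d. J k l * \<xi> l)" if "k < d" for k
    proof -
      have "(\<Sum>p<d. S k p * (\<Sum>q<d. H $$ (p, q) * v q)) = (\<Sum>q<d. (\<Sum>p<d. S k p * H $$ (p, q)) * v q)"
        by (simp add: sum_distrib_left sum_distrib_right mult.assoc) (rule sum.swap)
      also have "\<dots> = (\<Sum>q<d. (\<Sum>l<d. J k l * S l q) * v q)" using SH that by simp
      also have "\<dots> = (\<Sum>l<d. J k l * \<xi> l)"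
        by (simp add: \<xi>_def sum_distrib_left sum_distrib_right mult.assoc) (rule sum.swap)
      finally show ?thesis .
    qed
    have row: "b * (cmod (\<xi> k))\<^sup>2 - \<delta> / 2 * (d * (cmod (\<xi> k))\<^sup>2 + X) \<le> inner (\<xi> k) (\<Sum>l<d. J k l * \<xi> l)"
      if k: "k < d" for k
    proof -
      have entry: "(if l = k then b * (cmod (\<xi> k))\<^sup>2 else 0) - \<delta> / 2 * ((cmod (\<xi> k))\<^sup>2 + (cmod (\<xi> l))\<^sup>2)
          \<le> inner (\<xi> k) (J k l * \<xi> l)" if l: "l < d" for l
      proof (cases "l = k")
        case True
        have "inner (\<xi> k) (J k k * \<xi> k) = Re (J k k) * (cmod (\<xi> k))\<^sup>2"
          unfolding cmod_power2 by (simp add: inner_complex_def algebra_simps power2_eq_square)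
        moreover have "b * (cmod (\<xi> k))\<^sup>2 \<le> Re (J k k) * (cmod (\<xi> k))\<^sup>2"
          using ev[OF Jd[OF k]] by (intro mult_right_mono) auto
        moreover have "0 \<le> \<delta> / 2 * ((cmod (\<xi> k))\<^sup>2 + (cmod (\<xi> k))\<^sup>2)" using \<delta> by simp
        ultimately show ?thesis using True by simp
      next
        case False
        have "\<bar>inner (\<xi> k) (J k l * \<xi> l)\<bar> \<le> cmod (\<xi> k) * (cmod (J k l) * cmod (\<xi> l))"
          using Cauchy_Schwarz_ineq2[of "\<xi> k" "J k l * \<xi> l"] by (simp add: norm_mult)
        also have "\<dots> \<le> cmod (\<xi> k) * (\<delta> * cmod (\<xi> l))"
          using Jo[OF k l] False by (intro mult_left_mono mult_right_mono) auto
        also have "\<dots> = \<delta> / 2 * (2 * cmod (\<xi> k) * cmod (\<xi> l))" by simp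
        also have "\<dots> \<le> \<delta> / 2 * ((cmod (\<xi> k))\<^sup>2 + (cmod (\<xi> l))\<^sup>2)"
          using \<delta> sum_squares_bound[of "cmod (\<xi> k)" "cmod (\<xi> l)"] by (intro mult_left_mono) auto
        finally show ?thesis using False by simp
      qed
      have "(\<Sum>l<d. (if l = k then b * (cmod (\<xi> k))\<^sup>2 else 0) - \<delta> / 2 * ((cmod (\<xi> k))\<^sup>2 + (cmod (\<xi> l))\<^sup>2))
          \<le> (\<Sum>l<d. inner (\<xi> k) (J k l * \<xi> l))"
        using entry by (intro sum_mono) auto
      moreover have "(\<Sum>l<d. \<delta> / 2 * ((cmod (\<xi> k))\<^sup>2 + (cmod (\<xi> l))\<^sup>2)) = \<delta> / 2 * (d * (cmod (\<xi> k))\<^sup>2 + X)"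
        by (subst sum_distrib_left[symmetric]) (simp add: sum.distrib X_def)
      ultimately show ?thesis
        using k by (simp only: sum_subtractf inner_sum_right) (simp)
    qed
    have "\<alpha> * X \<le> b * X - \<delta> * d * X"
      using mult_right_mono[OF \<delta>(2) X0] by (simp add: algebra_simps)
    also have "\<dots> = (\<Sum>k<d. b * (cmod (\<xi> k))\<^sup>2 - \<delta> / 2 * (d * (cmod (\<xi> k))\<^sup>2 + X))"
    proof -
      have "(\<Sum>k<d. \<delta> / 2 * (d * (cmod (\<xi> k))\<^sup>2 + X)) = \<delta> / 2 * (d * X + d * X)"
        by (subst sum_distrib_left[symmetric]) (simp add: sum.distrib sum_distrib_left[symmetric] X_def[symmetric])
      moreover have "(\<Sum>k<d. b * (cmod (\<xi> k))\<^sup>2) = b * X" by (simp add: X_def sum_distrib_left)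
      ultimately show ?thesis by (simp only: sum_subtractf) simp
    qed
    also have "\<dots> \<le> (\<Sum>k<d. inner (\<xi> k) (\<Sum>l<d. J k l * \<xi> l))"
      using row by (intro sum_mono) auto
    finally show "\<alpha> * (\<Sum>k<d. (cmod (\<Sum>p<d. S k p * v p))\<^sup>2)
        \<le> (\<Sum>k<d. inner (\<Sum>p<d. S k p * v p) (\<Sum>p<d. S k p * (\<Sum>q<d. H $$ (p, q) * v q)))"
      using y by (simp add: X_def \<xi>_def)
  qed
qed

text \<open>
A real vector \<open>v\<close> has real coordinates \<open>Re (S v)\<^sub>k\<close> and \<open>Im (S v)\<^sub>k\<close>; the Boolean in the index tells
the two apart. There are twice as many coordinates as entries of \<open>v\<close>, hence only a left inverse
\<open>t\<close>. Being real, they can be applied to a tuple of vectors in place of \<open>v\<close>.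
\<close>

lemma dissipative_coordinates:
  fixes H :: "real Matrix.mat" and \<alpha> b :: real
  assumes H: "H \<in> carrier_mat d d" and "\<alpha> < b"
    and ev: "\<And>e. eigenvalue (map_mat complex_of_real H) e \<Longrightarrow> b \<le> Re e"
  obtains I :: "(nat \<times> bool) set" and s :: "nat \<times> bool \<Rightarrow> nat \<Rightarrow> real" and t where
    "finite I"
    "\<And>p q. p < d \<Longrightarrow> q < d \<Longrightarrow> (\<Sum>k\<in>I. t p k * s k q) = (if p = q then 1 else 0)"
    "\<And>v. \<alpha> * (\<Sum>k\<in>I. (\<Sum>p<d. s k p * v p)\<^sup>2)
        \<le> (\<Sum>k\<in>I. (\<Sum>p<d. s k p * v p) * (\<Sum>p<d. s k p * (\<Sum>q<d. H $$ (p, q) * v q)))"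
proof -
  let ?H = "map_mat complex_of_real H"
  have HC: "?H \<in> carrier_mat d d" using H by simp
  obtain S T where TS: "\<And>p q. p < d \<Longrightarrow> q < d \<Longrightarrow> (\<Sum>k<d. T p k * S k q) = (if p = q then 1 else 0)"
    and dis: "\<And>v. \<alpha> * (\<Sum>k<d. (cmod (\<Sum>p<d. S k p * v p))\<^sup>2)
        \<le> (\<Sum>k<d. inner (\<Sum>p<d. S k p * v p) (\<Sum>p<d. S k p * (\<Sum>q<d. ?H $$ (p, q) * v q)))"
    by (rule dissipative_complex_coordinates[OF HC \<open>\<alpha> < b\<close> ev]) (assumption, rule that)
  define I where "I = {..<d} \<times> (UNIV :: bool set)"
  define s where "s k p = (if snd k then Im (S (fst k) p) else Re (S (fst k) p))" for k p
  define t where "t p k = (if snd k then - Im (T p (fst k)) else Re (T p (fst k)))" for p k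
  have sumI: "(\<Sum>k\<in>I. f k) = (\<Sum>k<d. f (k, False) + f (k, True))" for f :: "nat \<times> bool \<Rightarrow> real"
    unfolding I_def sum.cartesian_product[symmetric, where g = "\<lambda>a b. f (a, b)", simplified]
    by (simp add: UNIV_bool add.commute)
  show thesis
  proof
    show "finite I" by (simp add: I_def)
  next
    fix p q assume "p < d" "q < d"
    then have "Re (\<Sum>k<d. T p k * S k q) = (if p = q then 1 else 0)" using TS by simp
    then show "(\<Sum>k\<in>I. t p k * s k q) = (if p = q then 1 else 0)"
      by (simp add: sumI s_def t_def)
  next
    fix v :: "nat \<Rightarrow> real"
    define w where "w p = (\<Sum>q<d. H $$ (p, q) * v q)" for p
    have w: "(\<Sum>q<d. ?H $$ (p, q) * of_real (v q)) = of_real (w p)" if "p < d" for p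
      using that H by (simp add: w_def)
    have rr: "(\<Sum>p<d. s (k, False) p * x p) = Re (\<Sum>p<d. S k p * of_real (x p))"
      and ri: "(\<Sum>p<d. s (k, True) p * x p) = Im (\<Sum>p<d. S k p * of_real (x p))" for k x
      by (simp_all add: s_def)
    have "(\<Sum>p<d. S k p * (\<Sum>q<d. ?H $$ (p, q) * of_real (v q))) = (\<Sum>p<d. S k p * of_real (w p))" for k
      using w by simp
    then show "\<alpha> * (\<Sum>k\<in>I. (\<Sum>p<d. s k p * v p)\<^sup>2)
        \<le> (\<Sum>k\<in>I. (\<Sum>p<d. s k p * v p) * (\<Sum>p<d. s k p * (\<Sum>q<d. H $$ (p, q) * v q)))"
      using dis[of "\<lambda>p. of_real (v p)"]
      unfolding w_def[symmetric] sumI rr ri inner_complex_def cmod_power2 by simp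
  qed
qed

section \<open>The Riccati equation and quadratic forms\<close>

lemma inner_matrix_vector_transpose:
  fixes X :: "real^'n^'m"
  shows "inner x (X *v y) = inner (Finite_Cartesian_Product.transpose X *v x) y"
  by (simp add: dot_lmul_matrix transpose_matrix_vector)

lemma single_row_mult: "((C :: real^'n^1) *v x) $ 1 = inner (C $ 1) x"
  by (simp add: matrix_vector_mult_def inner_vec_def)

text \<open>
The input always acts along \<open>P C\<^sup>T\<close>, which \<open>P\<^sup>-\<^sup>1\<close> maps back to the direction of the output.
\<close>

lemma gain_mult:
  "(\<mu> *\<^sub>R (P ** Finite_Cartesian_Product.transpose (C :: real^'n^1))) *v w = (\<mu> * w $ 1) *\<^sub>R (P *v (C $ 1))"
proof -
  have "Finite_Cartesian_Product.transpose C *v w = (w $ 1) *\<^sub>R (C $ 1)"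
    by (simp add: Finite_Cartesian_Product.vec_eq_iff matrix_vector_mult_def Finite_Cartesian_Product.transpose_def UNIV_1)
  then have "(P ** Finite_Cartesian_Product.transpose C) *v w = (w $ 1) *\<^sub>R (P *v (C $ 1))"
    by (simp add: matrix_vector_mul_assoc[symmetric] matrix_vector_mult_scaleR)
  then show ?thesis by (simp add: scaleR_matrix_vector_assoc[symmetric])
qed

text \<open>
The Riccati equation tested with the vector \<open>z\<close> on both sides. With \<open>z = P\<^sup>-\<^sup>1 x\<close> the left-hand side is
the derivative of \<open>x \<bullet> P\<^sup>-\<^sup>1 x\<close> along \<open>x' = A x\<close>.
\<close>

lemma riccati_quadratic_form:
  fixes A P :: "real^'n^'n" and C :: "real^'n^1"
  assumes "riccati A C P" "Finite_Cartesian_Product.transpose P = P"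
  shows "2 * inner z (A *v (P *v z)) = (inner (C $ 1) (P *v z))\<^sup>2 - (norm z)\<^sup>2"
proof -
  have "inner z ((A ** P + P ** Finite_Cartesian_Product.transpose A + Finite_Cartesian_Product.mat 1 - P ** Finite_Cartesian_Product.transpose C ** C ** P) *v z) = 0"
    using assms(1) by (simp add: riccati_def)
  moreover have "inner z (P *v (Finite_Cartesian_Product.transpose A *v z)) = inner z (A *v (P *v z))"
    using inner_matrix_vector_transpose[of z P "Finite_Cartesian_Product.transpose A *v z"] inner_matrix_vector_transpose[of z A "P *v z"] assms(2)
    by (simp add: inner_commute)
  moreover have "inner z (P *v (Finite_Cartesian_Product.transpose C *v (C *v (P *v z)))) = (inner (C $ 1) (P *v z))\<^sup>2"
  proof -
    have "inner z (P *v (Finite_Cartesian_Product.transpose C *v (C *v (P *v z)))) = inner (C *v (P *v z)) (C *v (P *v z))"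
      using inner_matrix_vector_transpose[of z P] inner_matrix_vector_transpose[of "P *v z" "Finite_Cartesian_Product.transpose C"] assms(2) by simp
    also have "\<dots> = (inner (C $ 1) (P *v z))\<^sup>2"
      by (simp add: inner_vec_def[of "C *v (P *v z)"] single_row_mult power2_eq_square UNIV_1)
    finally show ?thesis .
  qed
  ultimately show ?thesis
    by (simp add: matrix_vector_mult_add_rdistrib matrix_vector_mult_diff_rdistrib inner_add_right inner_diff_right
        matrix_vector_mul_assoc[symmetric] power2_norm_eq_inner)
qed

lemma matrix_norm_bound:
  fixes X :: "real^'n^'m"
  obtains b where "0 < b" "\<And>x. norm (X *v x) \<le> b * norm x"
  using bounded_linear.pos_bounded[OF matrix_vector_mul_bounded_linear[of X]] by (auto simp: mult.commute)

text \<open>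
The quadratic form attains a positive minimum on the compact unit sphere.
\<close>

lemma sym_pos_def_coercive:
  fixes P :: "real^'n^'n"
  assumes "sym_pos_def P"
  obtains p where "0 < p" "\<And>z. p * (norm z)\<^sup>2 \<le> inner z (P *v z)"
proof -
  have "\<exists>x\<in>sphere 0 1. \<forall>y\<in>sphere 0 1. inner x (P *v x) \<le> inner y (P *v y)"
    by (intro continuous_attains_inf continuous_intros) auto
  then obtain x where x: "norm x = 1" and min: "\<And>y. norm y = 1 \<Longrightarrow> inner x (P *v x) \<le> inner y (P *v y)"
    by auto
  show thesis
  proof
    show "0 < inner x (P *v x)" using assms x unfolding sym_pos_def_def by (metis norm_zero zero_neq_one)
  next
    fix z show "inner x (P *v x) * (norm z)\<^sup>2 \<le> inner z (P *v z)"
    proof (cases "z = 0")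
      case False
      have "inner x (P *v x) \<le> inner ((1 / norm z) *\<^sub>R z) (P *v ((1 / norm z) *\<^sub>R z))"
        using False by (intro min) simp
      also have "\<dots> = inner z (P *v z) / (norm z)\<^sup>2"
        by (simp add: matrix_vector_mult_scaleR power2_eq_square)
      finally show ?thesis using False by (simp add: field_simps)
    qed simp
  qed
qed

text \<open>
\<open>Q\<close> is the inverse of \<open>P\<close>. The last inequality converts the dissipation \<open>|P\<^sup>-\<^sup>1 x|\<^sup>2\<close> into a decay rate
for the storage \<open>x \<bullet> P\<^sup>-\<^sup>1 x\<close>.
\<close>

lemma inverse_quadratic_form:
  fixes P :: "real^'n^'n"
  assumes spd: "sym_pos_def P"
  obtains Q :: "real^'n^'n" and \<kappa> k1 k2 where
    "0 < \<kappa>" "0 < k1" "0 < k2"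
    "\<And>x. P *v (Q *v x) = x" "\<And>x y. inner (Q *v x) (P *v y) = inner x y"
    "\<And>x y. inner (Q *v x) y = inner x (Q *v y)"
    "\<And>x. (norm x)\<^sup>2 \<le> k1 * inner x (Q *v x)"
    "\<And>x. inner x (Q *v x) \<le> k2 * (norm x)\<^sup>2"
    "\<And>x. \<kappa> * inner x (Q *v x) \<le> (norm (Q *v x))\<^sup>2"
proof -
  have sym: "Finite_Cartesian_Product.transpose P = P" and pos: "\<And>v. v \<noteq> 0 \<Longrightarrow> 0 < inner v (P *v v)" using spd by (auto simp: sym_pos_def_def)
  have "inj ((*v) P)"
  proof (rule injI)
    fix x y assume "P *v x = P *v y"
    then have "inner (x - y) (P *v (x - y)) = 0" by (simp add: matrix_vector_mult_diff_distrib)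
    then show "x = y" using pos[of "x - y"] by auto
  qed
  then obtain Q where "Q ** P = Finite_Cartesian_Product.mat 1" using matrix_left_invertible_injective by blast
  then have PQ: "P *v (Q *v x) = x" and QP: "Q *v (P *v x) = x" for x
    using matrix_left_right_inverse[of Q P] by (auto simp: matrix_vector_mul_assoc)
  have PQi: "inner (Q *v x) (P *v y) = inner x y" for x y
    using inner_matrix_vector_transpose[of "Q *v x" P y] sym PQ by simp
  obtain p where p: "0 < p" "\<And>z. p * (norm z)\<^sup>2 \<le> inner z (P *v z)" by (rule sym_pos_def_coercive[OF spd]) blast
  obtain bP where bP: "0 < bP" "\<And>x. norm (P *v x) \<le> bP * norm x" by (rule matrix_norm_bound[of P]) blast
  obtain bQ where bQ: "0 < bQ" "\<And>x. norm (Q *v x) \<le> bQ * norm x" by (rule matrix_norm_bound[of Q]) blast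
  show thesis
  proof (rule that[of "1 / bP" "bP\<^sup>2 / p" bQ Q])
    show "0 < 1 / bP" "0 < bP\<^sup>2 / p" "0 < bQ" using bP bQ p by auto
    show "P *v (Q *v x) = x" "inner (Q *v x) (P *v y) = inner x y" for x y using PQ PQi by auto
    show "inner (Q *v x) y = inner x (Q *v y)" for x y using PQi[of x "Q *v y"] PQ by simp
    show "(norm x)\<^sup>2 \<le> bP\<^sup>2 / p * inner x (Q *v x)" for x
    proof -
      have "(norm x)\<^sup>2 \<le> (bP * norm (Q *v x))\<^sup>2" using bP(2)[of "Q *v x"] PQ by (intro power_mono) auto
      also have "\<dots> = bP\<^sup>2 / p * (p * (norm (Q *v x))\<^sup>2)" using p by (simp add: power_mult_distrib)
      also have "\<dots> \<le> bP\<^sup>2 / p * inner x (Q *v x)"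
        using p(2)[of "Q *v x"] p(1) PQ by (intro mult_left_mono) (auto simp: inner_commute)
      finally show ?thesis .
    qed
    show "inner x (Q *v x) \<le> bQ * (norm x)\<^sup>2" for x
    proof -
      have "inner x (Q *v x) \<le> norm x * norm (Q *v x)" by (rule norm_cauchy_schwarz)
      also have "\<dots> \<le> norm x * (bQ * norm x)" using bQ by (intro mult_left_mono) auto
      finally show ?thesis by (simp add: power2_eq_square algebra_simps)
    qed
    show "1 / bP * inner x (Q *v x) \<le> (norm (Q *v x))\<^sup>2" for x
    proof -
      have "inner x (Q *v x) \<le> norm x * norm (Q *v x)" by (rule norm_cauchy_schwarz)
      also have "\<dots> \<le> bP * norm (Q *v x) * norm (Q *v x)" using bP(2)[of "Q *v x"] PQ by (intro mult_right_mono) auto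
      finally show ?thesis using bP by (simp add: power2_eq_square field_simps)
    qed
  qed
qed

lemma norm_sum_scaleR_square_le:
  fixes x :: "'a \<Rightarrow> 'b::real_normed_vector"
  shows "(norm (\<Sum>p\<in>I. c p *\<^sub>R x p))\<^sup>2 \<le> (\<Sum>p\<in>I. (c p)\<^sup>2) * (\<Sum>p\<in>I. (norm (x p))\<^sup>2)"
proof -
  have "norm (\<Sum>p\<in>I. c p *\<^sub>R x p) \<le> (\<Sum>p\<in>I. \<bar>c p\<bar> * norm (x p))"
    using norm_sum[of "\<lambda>p. c p *\<^sub>R x p" I] by simp
  then have "(norm (\<Sum>p\<in>I. c p *\<^sub>R x p))\<^sup>2 \<le> (\<Sum>p\<in>I. \<bar>c p\<bar> * norm (x p))\<^sup>2" by (intro power_mono) auto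
  also have "\<dots> \<le> (\<Sum>p\<in>I. \<bar>c p\<bar>\<^sup>2) * (\<Sum>p\<in>I. (norm (x p))\<^sup>2)" by (rule Cauchy_Schwarz_ineq_sum)
  finally show ?thesis by simp
qed

section \<open>A storage function for the network\<close>

text \<open>
The balance of the scalar outputs \<open>u\<^sub>k = C \<xi>\<^sub>k\<close>: the Riccati equation supplies \<open>u\<^sub>k\<^sup>2\<close>, the coupling
\<open>y\<close> removes \<open>3/2\<close> of it, and the remaining \<open>- u\<^sub>k\<^sup>2 / 2\<close> completes the square with the input.
\<close>

lemma supply_rate_bound:
  fixes u y w :: "'a \<Rightarrow> real"
  assumes "0 < \<mu>" "3 / (4 * \<mu>) * (\<Sum>k\<in>I. (u k)\<^sup>2) \<le> (\<Sum>k\<in>I. u k * y k)"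
  shows "(\<Sum>k\<in>I. (u k)\<^sup>2 - 2 * \<mu> * (u k * (y k + w k))) \<le> 2 * \<mu>\<^sup>2 * (\<Sum>k\<in>I. (w k)\<^sup>2)"
proof -
  have "3 / 2 * (\<Sum>k\<in>I. (u k)\<^sup>2) \<le> 2 * \<mu> * (\<Sum>k\<in>I. u k * y k)"
    using mult_left_mono[OF assms(2), of "2 * \<mu>"] assms(1) by simp
  then have "(\<Sum>k\<in>I. (u k)\<^sup>2 - 2 * \<mu> * (u k * (y k + w k)))
      \<le> (\<Sum>k\<in>I. (u k)\<^sup>2 - 2 * \<mu> * (u k * w k)) - 3 / 2 * (\<Sum>k\<in>I. (u k)\<^sup>2)"
    by (simp add: sum_subtractf distrib_left sum.distrib sum_distrib_left[symmetric])
  also have "\<dots> = (\<Sum>k\<in>I. - (1 / 2) * (u k)\<^sup>2 - 2 * \<mu> * (u k * w k))"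
    by (simp add: sum_subtractf sum_negf flip: sum_divide_distrib)
  also have "\<dots> \<le> (\<Sum>k\<in>I. 2 * \<mu>\<^sup>2 * (w k)\<^sup>2)"
  proof (intro sum_mono)
    fix k
    have "0 \<le> (u k + 2 * \<mu> * w k)\<^sup>2 / 2" by simp
    then show "- (1 / 2) * (u k)\<^sup>2 - 2 * \<mu> * (u k * w k) \<le> 2 * \<mu>\<^sup>2 * (w k)\<^sup>2"
      by (simp add: power2_eq_square field_simps)
  qed
  finally show ?thesis by (simp add: sum_distrib_left)
qed

definition network_ode_at ::
    "real^'n^'n \<Rightarrow> real^'n^1 \<Rightarrow> real^1^'n \<Rightarrow> real Matrix.mat \<Rightarrow> nat \<Rightarrow>
     (nat \<Rightarrow> real \<Rightarrow> real^'n) \<Rightarrow> (nat \<Rightarrow> real) \<Rightarrow> real \<Rightarrow> real set \<Rightarrow> bool" where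
  "network_ode_at A C K H d \<zeta> w s F \<longleftrightarrow>
     (\<forall>p<d. (\<zeta> p has_vector_derivative
        A *v \<zeta> p s - K *v (C *v (\<Sum>q<d. H $$ (p, q) *\<^sub>R \<zeta> q s)) - K *v Finite_Cartesian_Product.vec (w p))
        (at s within F))"

text \<open>
The constants depend only on the matrices, not on the solution or on the input, so that one pair of
comparison functions serves all trajectories.
The two-sided bound of \<open>V\<close> rests on \<open>P\<close> being definite and on the left inverse \<open>t\<close> of the coordinates \<open>s\<close>.
\<close>

lemma coupled_storage_function:
  fixes A P :: "real^'n^'n" and C :: "real^'n^1" and H :: "real Matrix.mat"
  assumes spd: "sym_pos_def P" and ric: "riccati A C P"
    and H: "H \<in> carrier_mat d d"
    and ev: "\<And>e. eigenvalue (map_mat complex_of_real H) e \<Longrightarrow> b \<le> Re e"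
    and b: "0 < b" "1 / b \<le> \<mu>"
    and K: "K = \<mu> *\<^sub>R (P ** Finite_Cartesian_Product.transpose C)"
  obtains \<kappa> c1 c2 c3 :: real and V :: "(nat \<Rightarrow> real^'n) \<Rightarrow> real" where
    "\<And>\<zeta>. 0 \<le> V \<zeta>"
    "\<And>\<zeta> p. p < d \<Longrightarrow> (norm (\<zeta> p))\<^sup>2 \<le> c1 * V \<zeta>"
    "\<And>\<zeta>. V \<zeta> \<le> c2 * (\<Sum>p<d. (norm (\<zeta> p))\<^sup>2)"
    "\<And>\<zeta> w s F. network_ode_at A C K H d \<zeta> w s F \<Longrightarrow>
        \<exists>D. ((\<lambda>s. V (\<lambda>p. \<zeta> p s)) has_real_derivative D) (at s within F) \<and>
          D \<le> - \<kappa> * V (\<lambda>p. \<zeta> p s) + c3 * (\<Sum>p<d. (w p)\<^sup>2)"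
    "0 < \<kappa>" "0 < c1" "0 < c2" "0 < c3"
proof -
  have sym: "Finite_Cartesian_Product.transpose P = P" using spd by (simp add: sym_pos_def_def)
  have "0 < 1 / b" using b by simp
  then have mu: "0 < \<mu>" using b by linarith
  \<comment> \<open>any rate strictly between \<open>1 / (2 \<mu>)\<close> and \<open>1 / \<mu>\<close> would do\<close>
  have "3 / (4 * \<mu>) < 1 / \<mu>" using mu by (simp add: field_simps)
  also have "\<dots> \<le> b" using b mu by (simp add: field_simps)
  finally have mub: "3 / (4 * \<mu>) < b" .
  obtain I :: "(nat \<times> bool) set" and s t where finI: "finite I"
    and ts: "\<And>p q. p < d \<Longrightarrow> q < d \<Longrightarrow> (\<Sum>k\<in>I. t p k * s k q) = (if p = q then 1 else 0)"
    and dis: "\<And>v. 3 / (4 * \<mu>) * (\<Sum>k\<in>I. (\<Sum>p<d. s k p * v p)\<^sup>2)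
        \<le> (\<Sum>k\<in>I. (\<Sum>p<d. s k p * v p) * (\<Sum>p<d. s k p * (\<Sum>q<d. H $$ (p, q) * v q)))"
    by (rule dissipative_coordinates[OF H mub ev]) (assumption, rule that)
  obtain Q :: "real^'n^'n" and \<kappa> k1 k2 where \<kappa>: "0 < \<kappa>" and k1: "0 < k1" and k2: "0 < k2"
    and PQ: "\<And>x. P *v (Q *v x) = x" and QPi: "\<And>x y. inner (Q *v x) (P *v y) = inner x y"
    and Qs: "\<And>x y. inner (Q *v x) y = inner x (Q *v y)"
    and q1: "\<And>x. (norm x)\<^sup>2 \<le> k1 * inner x (Q *v x)"
    and q2: "\<And>x. inner x (Q *v x) \<le> k2 * (norm x)\<^sup>2"
    and q3: "\<And>x. \<kappa> * inner x (Q *v x) \<le> (norm (Q *v x))\<^sup>2"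
    by (rule inverse_quadratic_form[OF spd]) (rule that)
  define c where "c = C $ 1"
  define \<xi> where "\<xi> \<zeta> k = (\<Sum>p<d. s k p *\<^sub>R \<zeta> p)" for \<zeta> :: "nat \<Rightarrow> real^'n" and k
  define V where "V \<zeta> = (\<Sum>k\<in>I. inner (\<xi> \<zeta> k) (Q *v \<xi> \<zeta> k))" for \<zeta>
  \<comment> \<open>squared Frobenius norms of the coordinate change and of its left inverse\<close>
  define ss where "ss = (\<Sum>k\<in>I. \<Sum>p<d. (s k p)\<^sup>2)"
  define tt where "tt = (\<Sum>p<d. \<Sum>k\<in>I. (t p k)\<^sup>2)"
  have ss0: "0 \<le> ss" unfolding ss_def by (intro sum_nonneg) auto
  have tt0: "0 \<le> tt" unfolding tt_def by (intro sum_nonneg) auto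
  have q0: "0 \<le> inner x (Q *v x)" for x
    using q1[of x] k1 by (meson order_trans zero_le_mult_iff zero_le_power2 less_le_not_le)
  have V0: "0 \<le> V \<zeta>" for \<zeta> unfolding V_def using q0 by (intro sum_nonneg)
  have \<xi>sum: "(\<Sum>k\<in>I. (norm (\<Sum>p<d. s k p *\<^sub>R x p))\<^sup>2) \<le> ss * (\<Sum>p<d. (norm (x p))\<^sup>2)"
    for x :: "nat \<Rightarrow> 'b::real_normed_vector"
    unfolding ss_def sum_distrib_right[of _ I] by (intro sum_mono norm_sum_scaleR_square_le)
  show thesis
  \<comment> \<open>the summand \<open>1\<close> only keeps the constants positive when \<open>d = 0\<close>\<close>
  proof (rule that[where \<kappa> = \<kappa> and ?c1.0 = "tt * k1 + 1" and ?c2.0 = "k2 * ss + 1" and ?c3.0 = "2 * \<mu>\<^sup>2 * ss + 1" and V = V])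
    show "0 < \<kappa>" "0 < tt * k1 + 1" "0 < k2 * ss + 1" "0 < 2 * \<mu>\<^sup>2 * ss + 1"
      using \<kappa> k1 k2 ss0 tt0 by (auto intro: add_nonneg_pos)
    show "0 \<le> V \<zeta>" for \<zeta> by (rule V0)
    show "(norm (\<zeta> p))\<^sup>2 \<le> (tt * k1 + 1) * V \<zeta>" if p: "p < d" for \<zeta> p
    proof -
      have "(\<Sum>k\<in>I. t p k *\<^sub>R \<xi> \<zeta> k) = (\<Sum>q<d. (\<Sum>k\<in>I. t p k * s k q) *\<^sub>R \<zeta> q)"
        by (simp add: \<xi>_def scaleR_sum_right scaleR_sum_left) (rule sum.swap)
      also have "\<dots> = (\<Sum>q<d. if p = q then \<zeta> q else 0)" using ts p by (intro sum.cong) auto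
      also have "\<dots> = \<zeta> p" using p by simp
      finally have "(norm (\<zeta> p))\<^sup>2 \<le> (\<Sum>k\<in>I. (t p k)\<^sup>2) * (\<Sum>k\<in>I. (norm (\<xi> \<zeta> k))\<^sup>2)"
        using norm_sum_scaleR_square_le[of "t p" "\<xi> \<zeta>" I] by simp
      also have "\<dots> \<le> tt * (\<Sum>k\<in>I. k1 * inner (\<xi> \<zeta> k) (Q *v \<xi> \<zeta> k))"
      proof (intro mult_mono sum_mono q1 tt0)
        show "(\<Sum>k\<in>I. (t p k)\<^sup>2) \<le> tt"
          unfolding tt_def using p
          by (intro member_le_sum[where f = "\<lambda>p. \<Sum>k\<in>I. (t p k)\<^sup>2"]) (auto intro: sum_nonneg)
      qed (auto intro: sum_nonneg)
      also have "\<dots> = tt * k1 * V \<zeta>" by (simp add: V_def sum_distrib_left mult.assoc)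
      finally show ?thesis using V0[of \<zeta>] by (simp add: algebra_simps)
    qed
    show "V \<zeta> \<le> (k2 * ss + 1) * (\<Sum>p<d. (norm (\<zeta> p))\<^sup>2)" for \<zeta>
    proof -
      have "V \<zeta> \<le> (\<Sum>k\<in>I. k2 * (norm (\<xi> \<zeta> k))\<^sup>2)" unfolding V_def using q2 by (intro sum_mono)
      also have "\<dots> \<le> k2 * (ss * (\<Sum>p<d. (norm (\<zeta> p))\<^sup>2))"
        unfolding sum_distrib_left[symmetric] \<xi>_def using k2 \<xi>sum by (intro mult_left_mono) auto
      moreover have "0 \<le> (\<Sum>p<d. (norm (\<zeta> p))\<^sup>2)" by (intro sum_nonneg) auto
      ultimately show ?thesis by (simp add: algebra_simps)
    qed
    fix \<zeta> :: "nat \<Rightarrow> real \<Rightarrow> real^'n" and w \<tau> F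
    assume der: "network_ode_at A C K H d \<zeta> w \<tau> F"
    define x where "x k = \<xi> (\<lambda>p. \<zeta> p \<tau>) k" for k
    define u where "u k = inner c (x k)" for k
    define y where "y k = (\<Sum>p<d. s k p * (\<Sum>q<d. H $$ (p, q) * inner c (\<zeta> q \<tau>)))" for k
    define \<omega> where "\<omega> k = (\<Sum>p<d. s k p *\<^sub>R w p)" for k
    have dx: "((\<lambda>\<tau>. \<xi> (\<lambda>p. \<zeta> p \<tau>) k) has_vector_derivative A *v x k - (\<mu> * (y k + \<omega> k)) *\<^sub>R (P *v c)) (at \<tau> within F)" for k
    proof -
      have "((\<lambda>\<tau>. \<xi> (\<lambda>p. \<zeta> p \<tau>) k) has_vector_derivative (\<Sum>p<d. s k p *\<^sub>R
          (A *v \<zeta> p \<tau> - (\<mu> * ((\<Sum>q<d. H $$ (p, q) * inner c (\<zeta> q \<tau>)) + w p)) *\<^sub>R (P *v c)))) (at \<tau> within F)"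
        unfolding \<xi>_def
      proof (intro has_vector_derivative_sum bounded_linear.has_vector_derivative[OF bounded_linear_scaleR_right])
        fix p assume "p \<in> {..<d}"
        then show "(\<zeta> p has_vector_derivative
          (A *v \<zeta> p \<tau> - (\<mu> * ((\<Sum>q<d. H $$ (p, q) * inner c (\<zeta> q \<tau>)) + w p)) *\<^sub>R (P *v c))) (at \<tau> within F)"
          using der
          by (simp add: network_ode_at_def K gain_mult single_row_mult c_def inner_sum_right distrib_left scaleR_add_left diff_diff_eq)
      qed
      moreover have "(\<Sum>p<d. s k p *\<^sub>R (A *v \<zeta> p \<tau> - (\<mu> * ((\<Sum>q<d. H $$ (p, q) * inner c (\<zeta> q \<tau>)) + w p)) *\<^sub>R (P *v c)))
          = A *v x k - (\<mu> * (y k + \<omega> k)) *\<^sub>R (P *v c)"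
      proof -
        have "A *v x k = (\<Sum>p<d. s k p *\<^sub>R (A *v \<zeta> p \<tau>))"
          by (simp add: x_def \<xi>_def linear_sum[OF matrix_vector_mul_linear] matrix_vector_mult_scaleR)
        moreover have "\<mu> * (y k + \<omega> k) = (\<Sum>p<d. s k p * (\<mu> * ((\<Sum>q<d. H $$ (p, q) * inner c (\<zeta> q \<tau>)) + w p)))"
          by (simp add: y_def \<omega>_def distrib_left sum.distrib sum_distrib_left mult.left_commute)
        ultimately show ?thesis
          by (simp add: scaleR_diff_right sum_subtractf scaleR_sum_left)
      qed
      ultimately show ?thesis by simp
    qed
    define D where "D = (\<Sum>k\<in>I. 2 * inner (Q *v x k) (A *v x k - (\<mu> * (y k + \<omega> k)) *\<^sub>R (P *v c)))"
    have "((\<lambda>\<tau>. V (\<lambda>p. \<zeta> p \<tau>)) has_real_derivative D) (at \<tau> within F)"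
      unfolding V_def D_def
    proof (rule DERIV_sum)
      fix k assume "k \<in> I"
      let ?x' = "A *v x k - (\<mu> * (y k + \<omega> k)) *\<^sub>R (P *v c)"
      have dQ: "((\<lambda>\<tau>. Q *v \<xi> (\<lambda>p. \<zeta> p \<tau>) k) has_vector_derivative Q *v ?x') (at \<tau> within F)"
        by (rule bounded_linear.has_vector_derivative[OF matrix_vector_mul_bounded_linear dx])
      have "((\<lambda>\<tau>. inner (\<xi> (\<lambda>p. \<zeta> p \<tau>) k) (Q *v \<xi> (\<lambda>p. \<zeta> p \<tau>) k)) has_vector_derivative
          inner (x k) (Q *v ?x') + inner ?x' (Q *v x k)) (at \<tau> within F)"
        unfolding x_def
        by (rule bounded_bilinear.has_vector_derivative[OF bounded_bilinear_inner dx[unfolded x_def] dQ[unfolded x_def]])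
      moreover have "inner (x k) (Q *v ?x') + inner ?x' (Q *v x k) = 2 * inner (Q *v x k) ?x'"
        using Qs[of "x k" ?x'] by (simp only: inner_commute[of ?x'])
      ultimately show "((\<lambda>\<tau>. inner (\<xi> (\<lambda>p. \<zeta> p \<tau>) k) (Q *v \<xi> (\<lambda>p. \<zeta> p \<tau>) k)) has_real_derivative
          2 * inner (Q *v x k) ?x') (at \<tau> within F)"
        by (simp only: has_real_derivative_iff_has_vector_derivative)
    qed
    moreover have "D \<le> - \<kappa> * V (\<lambda>p. \<zeta> p \<tau>) + (2 * \<mu>\<^sup>2 * ss + 1) * (\<Sum>p<d. (w p)\<^sup>2)"
    proof -
      have eq: "2 * inner (Q *v x k) (A *v x k - (\<mu> * (y k + \<omega> k)) *\<^sub>R (P *v c))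
          = ((u k)\<^sup>2 - 2 * \<mu> * (u k * (y k + \<omega> k))) - (norm (Q *v x k))\<^sup>2" for k
        using riccati_quadratic_form[OF ric sym, of "Q *v x k"] QPi[of "x k" c] PQ[of "x k"]
        by (simp add: u_def c_def inner_diff_right inner_commute right_diff_distrib)
      have uy: "3 / (4 * \<mu>) * (\<Sum>k\<in>I. (u k)\<^sup>2) \<le> (\<Sum>k\<in>I. u k * y k)"
        using dis[of "\<lambda>p. inner c (\<zeta> p \<tau>)"] by (simp add: u_def x_def \<xi>_def y_def inner_sum_right)
      have "D = (\<Sum>k\<in>I. (u k)\<^sup>2 - 2 * \<mu> * (u k * (y k + \<omega> k))) - (\<Sum>k\<in>I. (norm (Q *v x k))\<^sup>2)"
        unfolding D_def eq by (rule sum_subtractf)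
      also have "\<dots> \<le> 2 * \<mu>\<^sup>2 * (\<Sum>k\<in>I. (\<omega> k)\<^sup>2) - (\<Sum>k\<in>I. \<kappa> * inner (x k) (Q *v x k))"
        using q3 by (intro diff_mono supply_rate_bound[OF mu uy] sum_mono)
      also have "\<dots> \<le> 2 * \<mu>\<^sup>2 * (ss * (\<Sum>p<d. (w p)\<^sup>2)) - \<kappa> * V (\<lambda>p. \<zeta> p \<tau>)"
        using \<xi>sum[of w] by (intro diff_mono mult_left_mono) (auto simp: \<omega>_def V_def x_def sum_distrib_left)
      moreover have "0 \<le> (\<Sum>p<d. (w p)\<^sup>2)" by (intro sum_nonneg) auto
      ultimately show ?thesis by (simp add: algebra_simps)
    qed
    ultimately show "\<exists>D. ((\<lambda>\<tau>. V (\<lambda>p. \<zeta> p \<tau>)) has_real_derivative D) (at \<tau> within F) \<and>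
          D \<le> - \<kappa> * V (\<lambda>p. \<zeta> p \<tau>) + (2 * \<mu>\<^sup>2 * ss + 1) * (\<Sum>p<d. (w p)\<^sup>2)" by blast
  qed
qed

section \<open>Decay of storage functions\<close>

text \<open>
The derivative of \<open>exp (\<kappa> (s - T)) (v s - b / \<kappa>)\<close> is nonpositive. The starting time \<open>T\<close> is
arbitrary because the convergence claim restarts the estimate once the input has become small.
\<close>

lemma exponential_comparison:
  fixes v :: "real \<Rightarrow> real"
  assumes "0 < \<kappa>" "0 \<le> b" "T \<le> t"
    and der: "\<And>s. T \<le> s \<Longrightarrow> \<exists>D. (v has_real_derivative D) (at s within {T..}) \<and> D \<le> - \<kappa> * v s + b"
  shows "v t \<le> exp (- \<kappa> * (t - T)) * v T + b / \<kappa>"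
proof -
  define f where "f s = exp (\<kappa> * (s - T)) * (v s - b / \<kappa>)" for s
  have df: "\<exists>D. (f has_real_derivative D) (at s within {T..}) \<and> D \<le> 0" if s: "T \<le> s" for s
  proof -
    obtain D where D: "(v has_real_derivative D) (at s within {T..})" "D \<le> - \<kappa> * v s + b" using der[OF s] by auto
    have "(f has_real_derivative exp (\<kappa> * (s - T)) * (D + \<kappa> * (v s - b / \<kappa>))) (at s within {T..})"
      unfolding f_def by (rule derivative_eq_intros D(1) refl | simp add: algebra_simps)+
    moreover have "D + \<kappa> * (v s - b / \<kappa>) \<le> 0" using D(2) \<open>0 < \<kappa>\<close> by (simp add: right_diff_distrib)
    ultimately show ?thesis using mult_nonneg_nonpos[of "exp (\<kappa> * (s - T))"] by auto
  qed
  have "f t \<le> f T"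
  proof (rule DERIV_nonpos_imp_decreasing_open[OF \<open>T \<le> t\<close>])
    fix s assume "T < s" "s < t"
    then have "at s within {T..} = at s" by (intro at_within_interior) (auto simp: interior_real_atLeast)
    then show "\<exists>y. DERIV f s :> y \<and> y \<le> 0" using df[of s] \<open>T < s\<close> by auto
  next
    have "continuous_on {T..} f"
      using df by (meson DERIV_continuous atLeast_iff continuous_on_eq_continuous_within)
    then show "continuous_on {T..t} f" by (rule continuous_on_subset) auto
  qed
  then have "exp (- (\<kappa> * (t - T))) * f t \<le> exp (- (\<kappa> * (t - T))) * f T"
    by (intro mult_left_mono) auto
  moreover have "exp (- (\<kappa> * (t - T))) * f t = v t - b / \<kappa>"
    unfolding f_def mult.assoc[symmetric] exp_add[symmetric] by simp
  ultimately have "v t - b / \<kappa> \<le> exp (- (\<kappa> * (t - T))) * (v T - b / \<kappa>)"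
    by (simp only:) (simp add: f_def)
  also have "\<dots> \<le> exp (- (\<kappa> * (t - T))) * v T"
    using assms by (intro mult_left_mono) auto
  finally show ?thesis by simp
qed

text \<open>
After the time \<open>T\<close> from which \<open>b\<close> stays below \<open>e \<kappa> / 2\<close>, the input accounts for at most \<open>e / 2\<close>
and the memory of \<open>v T\<close> decays.
\<close>

lemma vanishing_input_imp_vanishing_storage:
  fixes v b :: "real \<Rightarrow> real"
  assumes "0 < \<kappa>" and v0: "\<And>t. 0 \<le> v t" and b: "(b \<longlongrightarrow> 0) at_top"
    and der: "\<And>s. 0 \<le> s \<Longrightarrow> \<exists>D. (v has_real_derivative D) (at s within {0..}) \<and> D \<le> - \<kappa> * v s + b s"
  shows "(v \<longlongrightarrow> 0) at_top"
proof (rule order_tendstoI)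
  fix e :: real assume "e < 0"
  then show "\<forall>\<^sub>F t in at_top. e < v t" using v0 by (intro always_eventually) (auto intro: less_le_trans)
next
  fix e :: real assume e: "0 < e"
  then have "\<forall>\<^sub>F t in at_top. b t < e * \<kappa> / 2" using order_tendstoD(2)[OF b, of "e * \<kappa> / 2"] \<open>0 < \<kappa>\<close> by simp
  then obtain T0 where "\<And>t. T0 \<le> t \<Longrightarrow> b t < e * \<kappa> / 2" by (auto simp: eventually_at_top_linorder)
  then obtain T where T: "0 \<le> T" "\<And>t. T \<le> t \<Longrightarrow> b t < e * \<kappa> / 2"
    by (meson max.bounded_iff max.cobounded1 order_refl)
  have le: "v t \<le> exp (- \<kappa> * (t - T)) * v T + e / 2" if "T \<le> t" for t
  proof -
    have "\<exists>D. (v has_real_derivative D) (at s within {T..}) \<and> D \<le> - \<kappa> * v s + e * \<kappa> / 2" if s: "T \<le> s" for s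
    proof -
      obtain D where "(v has_real_derivative D) (at s within {0..})" "D \<le> - \<kappa> * v s + b s"
        using der[of s] s T by auto
      moreover have "{T..} \<subseteq> {0::real..}" using T by auto
      ultimately show ?thesis using T(2)[OF s] by (meson DERIV_subset add_left_mono less_imp_le order_trans)
    qed
    from exponential_comparison[OF \<open>0 < \<kappa>\<close> _ that this] show ?thesis using e \<open>0 < \<kappa>\<close> by simp
  qed
  have "((\<lambda>t. exp (- \<kappa> * (t - T)) * v T) \<longlongrightarrow> 0) at_top" using \<open>0 < \<kappa>\<close> by real_asymp
  then have "\<forall>\<^sub>F t in at_top. exp (- \<kappa> * (t - T)) * v T < e / 2" using order_tendstoD(2)[of _ 0 at_top "e / 2"] e by simp
  then show "\<forall>\<^sub>F t in at_top. v t < e"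
    using eventually_ge_at_top[of T] by eventually_elim (use le in fastforce)
qed

section \<open>The error system of the compensator\<close>

text \<open>
In the last equation of a block the terms \<open>K C (\<Sum>j. a i j \<eta>\<^sub>i\<^sub>1)\<close> and \<open>K (\<Sum>j. a i j y\<^sub>i)\<close> combine: replacing
each output by \<open>y\<^sub>j = C \<eta>\<^sub>j\<^sub>1 + e\<^sub>j\<close> cancels \<open>\<eta>\<^sub>i\<^sub>1\<close>, brings in the neighbours' \<open>\<eta>\<^sub>j\<^sub>1\<close>, and leaves
the output errors as input. The leader has no output error, and its term \<open>a i 0 C x0\<close> completes the shift
of all states by \<open>x0\<close>.
\<close>

lemma compensator_error_equation:
  assumes lead: "leader_solution A x0" and comp: "compensator_solution N r a A C K (outp C x0 x) \<eta>"
    and i: "i \<in> {1..N}" and k: "k \<in> {1..r i + 1}" and t: "0 \<le> t"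
  shows "(etabar x0 \<eta> i k has_vector_derivative A *v etabar x0 \<eta> i k t
     - K *v (C *v (if k \<le> r i then etabar x0 \<eta> i k t - etabar x0 \<eta> i (k + 1) t
          else in_weight N a i *\<^sub>R etabar x0 \<eta> i (r i + 1) t - (\<Sum>j=1..N. a i j *\<^sub>R etabar x0 \<eta> j 1 t)))
     - K *v Finite_Cartesian_Product.vec (if k \<le> r i then 0
          else in_weight N a i * ehat C x \<eta> i t - (\<Sum>j=1..N. a i j * ehat C x \<eta> j t))) (at t within {0..})"
proof -
  have x0: "(x0 has_vector_derivative A *v x0 t) (at t within {0..})"
    using lead t by (simp add: leader_solution_def)
  have eb: "etabar x0 \<eta> i k = (\<lambda>t. \<eta> i k t - x0 t)" by (simp add: etabar_def fun_eq_iff)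
  show ?thesis
  proof (cases "k \<le> r i")
    case True
    have "(\<eta> i k has_vector_derivative
              A *v \<eta> i k t - K *v (C *v (\<eta> i k t - \<eta> i (k + 1) t))) (at t within {0..})"
      using comp i k t True by (simp add: compensator_solution_def)
    from has_vector_derivative_diff[OF this x0] show ?thesis
      using True unfolding eb
      by (simp add: etabar_def matrix_vector_mult_diff_distrib algebra_simps vec_0)
  next
    case False
    then have k: "k = r i + 1" using k by simp
    define Y where "Y = C *v (\<Sum>j=0..N. a i j *\<^sub>R (\<eta> i (r i + 1) t - \<eta> i 1 t))
        + Finite_Cartesian_Product.vec (\<Sum>j=0..N. a i j * (outp C x0 x i t - outp C x0 x j t))"
    have "(\<eta> i k has_vector_derivative A *v \<eta> i k t
           - K *v (C *v (\<Sum>j=0..N. a i j *\<^sub>R (\<eta> i (r i + 1) t - \<eta> i 1 t)))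
           - K *v Finite_Cartesian_Product.vec (\<Sum>j=0..N. a i j * (outp C x0 x i t - outp C x0 x j t)))
          (at t within {0..})"
      using comp i k t by (simp add: compensator_solution_def)
    then have "(\<eta> i k has_vector_derivative A *v \<eta> i k t - K *v Y) (at t within {0..})"
      by (simp add: Y_def matrix_vector_right_distrib diff_diff_eq)
    from has_vector_derivative_diff[OF this x0]
    have "(etabar x0 \<eta> i k has_vector_derivative A *v etabar x0 \<eta> i k t - K *v Y) (at t within {0..})"
      unfolding eb by (simp add: matrix_vector_mult_diff_distrib algebra_simps)
    moreover have "Y = C *v (in_weight N a i *\<^sub>R etabar x0 \<eta> i (r i + 1) t - (\<Sum>j=1..N. a i j *\<^sub>R etabar x0 \<eta> j 1 t))
      + Finite_Cartesian_Product.vec (in_weight N a i * ehat C x \<eta> i t - (\<Sum>j=1..N. a i j * ehat C x \<eta> j t))"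
    proof -
      define c where "c = C $ 1"
      define W where "W = (\<Sum>j=1..N. a i j)"
      have w: "in_weight N a i = a i 0 + W"
        by (simp add: in_weight_def sum.atLeast_Suc_atMost W_def)
      have "Y $ 1 = in_weight N a i * (inner c (\<eta> i (r i + 1) t) - inner c (\<eta> i 1 t))
          + (\<Sum>j=0..N. a i j * (x i 1 t - outp C x0 x j t))"
        using i by (simp add: Y_def single_row_mult c_def in_weight_def inner_diff_right outp_def flip: scaleR_sum_left)
      also have "(\<Sum>j=0..N. a i j * (x i 1 t - outp C x0 x j t))
          = a i 0 * (x i 1 t - inner c (x0 t)) + (W * x i 1 t - (\<Sum>j=1..N. a i j * x j 1 t))"
        by (simp add: sum.atLeast_Suc_atMost outp_def single_row_mult c_def right_diff_distrib sum_subtractf W_def sum_distrib_right)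
      finally have Y1: "Y $ 1 = in_weight N a i * (inner c (\<eta> i (r i + 1) t) - inner c (\<eta> i 1 t))
          + (a i 0 * (x i 1 t - inner c (x0 t)) + (W * x i 1 t - (\<Sum>j=1..N. a i j * x j 1 t)))" .
      have s1: "(\<Sum>j=1..N. a i j * ehat C x \<eta> j t) = (\<Sum>j=1..N. a i j * x j 1 t) - (\<Sum>j=1..N. a i j * inner c (\<eta> j 1 t))"
        by (simp add: ehat_def single_row_mult c_def right_diff_distrib sum_subtractf)
      have s2: "inner c (\<Sum>j=1..N. a i j *\<^sub>R etabar x0 \<eta> j 1 t) = (\<Sum>j=1..N. a i j * inner c (\<eta> j 1 t)) - W * inner c (x0 t)"
        by (simp add: inner_sum_right etabar_def inner_diff_right right_diff_distrib sum_subtractf W_def sum_distrib_right)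
      have "(C *v (in_weight N a i *\<^sub>R etabar x0 \<eta> i (r i + 1) t - (\<Sum>j=1..N. a i j *\<^sub>R etabar x0 \<eta> j 1 t))
        + Finite_Cartesian_Product.vec (in_weight N a i * ehat C x \<eta> i t - (\<Sum>j=1..N. a i j * ehat C x \<eta> j t))) $ 1
        = in_weight N a i * (inner c (\<eta> i (r i + 1) t) - inner c (x0 t))
          - ((\<Sum>j=1..N. a i j * inner c (\<eta> j 1 t)) - W * inner c (x0 t))
          + (in_weight N a i * (x i 1 t - inner c (\<eta> i 1 t))
          - ((\<Sum>j=1..N. a i j * x j 1 t) - (\<Sum>j=1..N. a i j * inner c (\<eta> j 1 t))))"
        unfolding vector_add_component single_row_mult c_def[symmetric] inner_diff_right s2 s1
        by (simp add: etabar_def inner_diff_right ehat_def single_row_mult c_def)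
      also have "\<dots> = Y $ 1" unfolding Y1 w by (simp add: algebra_simps)
      finally show ?thesis by (simp add: Finite_Cartesian_Product.vec_eq_iff forall_1)
    qed
    ultimately show ?thesis using False k
      by (simp add: matrix_vector_right_distrib diff_diff_eq)
  qed
qed

text \<open>
The set of times where the bound holds is closed and has full measure, hence contains the open half-line
and, by closure, its end point as well.
\<close>

lemma esssup_half_line_bounds_continuous:
  fixes f :: "real \<Rightarrow> real"
  assumes f: "continuous_on {0..} f" and t: "0 \<le> t"
  shows "ereal (f t) \<le> esssup (lebesgue_on {0..}) (\<lambda>t. ereal (f t))"
proof -
  define L where "L = esssup (lebesgue_on {0..}) (\<lambda>t. ereal (f t))"
  have "AE x in lebesgue_on {0..}. ereal (f x) \<le> L" unfolding L_def by (rule esssup_AE)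
  then have ae: "AE x in lebesgue. 0 \<le> x \<longrightarrow> ereal (f x) \<le> L"
    by (simp add: AE_restrict_space_iff)
  define S where "S = {x \<in> {0..}. ereal (f x) \<le> L}"
  have "S = {0..} \<inter> (\<lambda>x. ereal (f x)) -` {..L}" by (auto simp: S_def)
  moreover have "continuous_on {0..} (\<lambda>x. ereal (f x))" using f by (intro continuous_intros)
  ultimately have S: "closed S" using continuous_closed_preimage[of "{0..}" "\<lambda>x. ereal (f x)" "{..L}"] by simp
  have "{0<..} \<subseteq> S"
  proof
    fix x :: real assume "x \<in> {0<..}"
    moreover have "AE x in lebesgue. x \<in> {0<..} \<longrightarrow> x \<in> S" using ae by eventually_elim (auto simp: S_def)
    ultimately show "x \<in> S" using mem_closed_if_AE_lebesgue_open[OF open_greaterThan S] by blast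
  qed
  then have "closure {0<..} \<subseteq> S" using S by (rule closure_minimal)
  then show ?thesis using t by (auto simp: S_def L_def)
qed

text \<open>
Being a difference of differentiable signals, \<open>ehat\<close> is continuous; the first follower state is
differentiable because the chain of integrators has length at least one.
\<close>

lemma ehat_norm_le_Linf_norm:
  assumes r: "\<And>i. i \<in> {1..N} \<Longrightarrow> 1 \<le> r i"
    and fol: "follower_solution N r m \<psi> \<theta> u x" and comp: "compensator_solution N r a A C K y \<eta>"
    and fin: "Linf_norm N (ehat C x \<eta>) < \<infinity>" and t: "0 \<le> t"
  shows "L2_set (\<lambda>i. ehat C x \<eta> i t) {1..N} \<le> real_of_ereal (Linf_norm N (ehat C x \<eta>))"
proof -
  have "continuous_on {0..} (ehat C x \<eta> i)" if i: "i \<in> {1..N}" for i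
  proof -
    have "continuous_on {0..} (x i 1)"
    proof (rule DERIV_continuous_on)
      fix t :: real assume "t \<in> {0..}"
      then have t: "0 \<le> t" by simp
      let ?D = "(\<Sum>k=1..m i. \<psi> i 1 (\<lambda>s. x i s t) k * \<theta> i k)"
      show "(x i 1 has_real_derivative (if 1 < r i then x i (1 + 1) t else u i t) + ?D) (at t within {0..})"
      proof (cases "1 < r i")
        case True
        then have "1 \<in> {1..<r i}" by simp
        then show ?thesis using fol i t True unfolding follower_solution_def by simp
      next
        case False
        then have "r i = 1" using r[OF i] by simp
        moreover have "(x i (r i) has_real_derivative
            u i t + (\<Sum>k=1..m i. \<psi> i (r i) (\<lambda>s. x i s t) k * \<theta> i k)) (at t within {0..})"
          using fol i t unfolding follower_solution_def by blast
        ultimately show ?thesis by simp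
      qed
    qed
    moreover have "continuous_on {0..} (\<eta> i 1)"
    proof (rule continuous_on_vector_derivative)
      fix t :: real assume "t \<in> {0..}"
      then show "(\<eta> i 1 has_vector_derivative A *v \<eta> i 1 t - K *v (C *v (\<eta> i 1 t - \<eta> i (1 + 1) t))) (at t within {0..})"
        using comp i r[OF i] by (auto simp: compensator_solution_def)
    qed
    ultimately show ?thesis unfolding ehat_def single_row_mult by (intro continuous_intros)
  qed
  then have "continuous_on {0..} (\<lambda>t. L2_set (\<lambda>i. ehat C x \<eta> i t) {1..N})"
    unfolding L2_set_def by (intro continuous_intros) auto
  from esssup_half_line_bounds_continuous[OF this t]
  have "ereal (L2_set (\<lambda>i. ehat C x \<eta> i t) {1..N}) \<le> Linf_norm N (ehat C x \<eta>)"
    by (simp add: Linf_norm_def)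
  then show ?thesis using fin by (cases "Linf_norm N (ehat C x \<eta>)") auto
qed

section \<open>Comparison functions and the input-to-state estimate\<close>

lemma class_KL_exponential:
  assumes "0 < c" "0 < \<kappa>"
  shows "class_KL (\<lambda>s t. c * exp (- \<kappa> * t) * s)"
  unfolding class_KL_def class_K_def
proof (intro conjI allI impI)
  fix t :: real
  show "continuous_on {0..} (\<lambda>s. c * exp (- \<kappa> * t) * s)" by (intro continuous_intros)
  show "strict_mono_on {0..} (\<lambda>s. c * exp (- \<kappa> * t) * s)" using assms by (auto intro!: strict_mono_onI)
next
  fix s :: real assume s: "0 < s"
  show "antimono_on {0..} (\<lambda>t. c * exp (- \<kappa> * t) * s)"
    using assms s by (intro monotone_onI) (auto intro!: mult_left_mono mult_right_mono)
  show "((\<lambda>t. c * exp (- \<kappa> * t) * s) \<longlongrightarrow> 0) at_top" using assms by real_asymp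
qed simp

lemma class_K_linear: "0 < c \<Longrightarrow> class_K (\<lambda>s. c * s)"
  unfolding class_K_def by (auto intro!: continuous_intros strict_mono_onI)

theorem theorem1:
  fixes N :: nat
    and r m :: "nat \<Rightarrow> nat"
    and \<psi> :: "nat \<Rightarrow> nat \<Rightarrow> (nat \<Rightarrow> real) \<Rightarrow> nat \<Rightarrow> real"
    and \<theta> :: "nat \<Rightarrow> nat \<Rightarrow> real"
    and A P0 :: "real^'n^'n"
    and C :: "real^'n^1"
    and K :: "real^1^'n"
    and E :: "(nat \<times> nat) set"
    and a :: "nat \<Rightarrow> nat \<Rightarrow> real"
    and \<sigma> :: complex
    and \<mu> :: real
  assumes "1 \<le> N"
    and "\<And>i. i \<in> {1..N} \<Longrightarrow> 1 \<le> r i"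
    and "\<And>i l k. i \<in> {1..N} \<Longrightarrow> l \<in> {1..r i} \<Longrightarrow> k \<in> {1..m i} \<Longrightarrow>
           smooth_on_Rl l (\<lambda>z. \<psi> i l z k)"
    and "detectable A C"
    and "weighted_digraph N E a"
    and "has_spanning_tree {0..N} E 0"
    and "sym_pos_def P0"
    and "riccati A C P0"
    and "smallest_Re_eigenvalue (Hhat N r a) \<sigma>"
    and "\<mu> \<ge> 1 / Re \<sigma>"
    and "K = \<mu> *\<^sub>R (P0 ** Finite_Cartesian_Product.transpose C)"
  shows
    "(\<exists>\<beta> \<gamma>. class_KL \<beta> \<and> class_K \<gamma> \<and>
        (\<forall>u x x0 \<eta>.
           follower_solution N r m \<psi> \<theta> u x \<and> leader_solution A x0 \<and>
           compensator_solution N r a A C K (outp C x0 x) \<eta> \<and>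
           Linf_norm N (ehat C x \<eta>) < \<infinity> \<longrightarrow>
           (\<forall>i\<in>{1..N}. \<forall>l\<in>{1..r i + 1}. \<forall>t\<ge>0.
              norm (etabar x0 \<eta> i l t) \<le>
                \<beta> (stacked_norm N r (\<lambda>i l. etabar x0 \<eta> i l 0)) t
                + \<gamma> (real_of_ereal (Linf_norm N (ehat C x \<eta>)))))) \<and>
     (\<forall>u x x0 \<eta>.
        follower_solution N r m \<psi> \<theta> u x \<and> leader_solution A x0 \<and>
        compensator_solution N r a A C K (outp C x0 x) \<eta> \<and>
        (\<forall>i\<in>{1..N}. (ehat C x \<eta> i \<longlongrightarrow> 0) at_top) \<longrightarrow>
        (\<forall>i\<in>{1..N}. \<forall>l\<in>{1..r i + 1}. (etabar x0 \<eta> i l \<longlongrightarrow> 0) at_top))"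
proof -
  define ix where "ix = block_index N r"
  define d where "d = length ix"
  have Hd: "Hhat N r a \<in> carrier_mat d d" using Hhat_carrier by (simp add: d_def ix_def)
  have \<sigma>: "eigenvalue (map_mat complex_of_real (Hhat N r a)) \<sigma>"
    and min: "\<And>e. eigenvalue (map_mat complex_of_real (Hhat N r a)) e \<Longrightarrow> Re \<sigma> \<le> Re e"
    using assms(9) by (auto simp: smallest_Re_eigenvalue_def is_arg_min_def not_less)
  have \<sigma>0: "0 < Re \<sigma>" by (rule Hhat_eigenvalue_Re_pos[OF assms(5,6) \<sigma>])
  obtain \<kappa> c1 c2 c3 and V :: "(nat \<Rightarrow> real^'n) \<Rightarrow> real" where
    V0: "\<And>\<zeta>. 0 \<le> V \<zeta>"
    and Vlow: "\<And>\<zeta> p. p < d \<Longrightarrow> (norm (\<zeta> p))\<^sup>2 \<le> c1 * V \<zeta>"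
    and Vup: "\<And>\<zeta>. V \<zeta> \<le> c2 * (\<Sum>p<d. (norm (\<zeta> p))\<^sup>2)"
    and Vder: "\<And>\<zeta> w s F. network_ode_at A C K (Hhat N r a) d \<zeta> w s F \<Longrightarrow>
        \<exists>D. ((\<lambda>s. V (\<lambda>p. \<zeta> p s)) has_real_derivative D) (at s within F) \<and>
          D \<le> - \<kappa> * V (\<lambda>p. \<zeta> p s) + c3 * (\<Sum>p<d. (w p)\<^sup>2)"
    and \<kappa>: "0 < \<kappa>" and c1: "0 < c1" and c2: "0 < c2" and c3: "0 < c3"
    by (rule coupled_storage_function[OF assms(7,8) Hd min \<sigma>0 assms(10,11)]) (assumption, rule that)
  \<comment> \<open>bound for the input at the last position of block \<open>i\<close> relative to the norm of \<open>ehat\<close>\<close>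
  define g where "g i = \<bar>in_weight N a i\<bar> + (\<Sum>j=1..N. \<bar>a i j\<bar>)" for i
  define W where "W = (\<Sum>p<d. (g (fst (ix ! p)))\<^sup>2)"
  have W0: "0 \<le> W" by (simp add: W_def sum_nonneg)
  define cW where "cW = c3 * W"
  have cW0: "0 \<le> cW" using c3 W0 by (simp add: cW_def)
  define v where "v x0 \<eta> t = V (\<lambda>p. etabar x0 \<eta> (fst (ix ! p)) (snd (ix ! p)) t)" for x0 \<eta> t
  have member: "\<exists>p<d. ix ! p = (i, k)" if "i \<in> {1..N}" "k \<in> {1..r i + 1}" for i k
  proof -
    have "(i, k) \<in> set ix" using that by (auto simp: ix_def set_block_index)
    then show ?thesis by (auto simp: in_set_conv_nth d_def)
  qed
  have vlow: "(norm (etabar x0 \<eta> i k t))\<^sup>2 \<le> c1 * v x0 \<eta> t" if ik: "i \<in> {1..N}" "k \<in> {1..r i + 1}" for x0 \<eta> i k t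
  proof -
    obtain p where "p < d" "ix ! p = (i, k)" using member[OF ik] by auto
    then show ?thesis using Vlow[of p "\<lambda>p. etabar x0 \<eta> (fst (ix ! p)) (snd (ix ! p)) t"] by (simp add: v_def)
  qed
  have vup: "v x0 \<eta> t \<le> c2 * (stacked_norm N r (\<lambda>i l. etabar x0 \<eta> i l t))\<^sup>2" for x0 \<eta> t
  proof -
    have "(\<Sum>p<d. (norm (etabar x0 \<eta> (fst (ix ! p)) (snd (ix ! p)) t))\<^sup>2)
        = (stacked_norm N r (\<lambda>i l. etabar x0 \<eta> i l t))\<^sup>2"
      using sum_block_index[of "\<lambda>x. (norm (etabar x0 \<eta> (fst x) (snd x) t))\<^sup>2" N r]
      by (simp add: stacked_norm_def L2_set_def d_def ix_def split_def sum_nonneg)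
    then show ?thesis using Vup[of "\<lambda>p. etabar x0 \<eta> (fst (ix ! p)) (snd (ix ! p)) t"] by (simp add: v_def)
  qed
  have vder: "\<exists>D. (v x0 \<eta> has_real_derivative D) (at s within {0..}) \<and>
        D \<le> - \<kappa> * v x0 \<eta> s + cW * (L2_set (\<lambda>i. ehat C x \<eta> i s) {1..N})\<^sup>2"
    if lead: "leader_solution A x0" and comp: "compensator_solution N r a A C K (outp C x0 x) \<eta>" and s: "0 \<le> s"
    for x x0 \<eta> s
  proof -
    let ?z = "\<lambda>p. etabar x0 \<eta> (fst (ix ! p)) (snd (ix ! p))"
    define L where "L = L2_set (\<lambda>i. ehat C x \<eta> i s) {1..N}"
    define w where "w p = (let (i, k) = ix ! p in if k \<le> r i then 0
          else in_weight N a i * ehat C x \<eta> i s - (\<Sum>j=1..N. a i j * ehat C x \<eta> j s))" for p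
    have eL: "\<bar>ehat C x \<eta> i s\<bar> \<le> L" if "i \<in> {1..N}" for i
      using member_le_L2_set[of "{1..N}" i "\<lambda>i. \<bar>ehat C x \<eta> i s\<bar>"] that by (simp add: L_def L2_set_def)
    have L0: "0 \<le> L" by (simp add: L_def)
    have wle: "(w p)\<^sup>2 \<le> (g (fst (ix ! p)))\<^sup>2 * L\<^sup>2" if p: "p < d" for p
    proof -
      obtain i k where ik: "ix ! p = (i, k)" by fastforce
      have "(i, k) \<in> set ix" using p ik by (metis d_def nth_mem)
      then have i: "i \<in> {1..N}" by (auto simp: ix_def set_block_index)
      have "\<bar>in_weight N a i * ehat C x \<eta> i s - (\<Sum>j=1..N. a i j * ehat C x \<eta> j s)\<bar>
          \<le> \<bar>in_weight N a i * ehat C x \<eta> i s\<bar> + \<bar>\<Sum>j=1..N. a i j * ehat C x \<eta> j s\<bar>" by (rule abs_triangle_ineq4)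
      also have "\<dots> \<le> \<bar>in_weight N a i\<bar> * L + (\<Sum>j=1..N. \<bar>a i j\<bar> * L)"
        using eL i by (intro add_mono order_trans[OF sum_abs] sum_mono) (auto simp: abs_mult intro!: mult_left_mono)
      also have "\<dots> = g i * L" by (simp add: g_def sum_distrib_right distrib_right)
      finally have "\<bar>w p\<bar> \<le> \<bar>g i * L\<bar>" using ik L0 by (auto simp: w_def g_def)
      then show ?thesis using ik by (simp add: power_mult_distrib[symmetric] abs_le_square_iff)
    qed
    have "network_ode_at A C K (Hhat N r a) d ?z w s {0..}"
      unfolding network_ode_at_def
    proof (intro allI impI)
      fix p assume p: "p < d"
      obtain i k where ik: "ix ! p = (i, k)" by fastforce
      have "(i, k) \<in> set ix" using p ik by (metis d_def nth_mem)
      then have i: "i \<in> {1..N}" "k \<in> {1..r i + 1}" by (auto simp: ix_def set_block_index)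
      have ai: "a i i = 0" using assms(5) i by (auto simp: weighted_digraph_def)
      show "(?z p has_vector_derivative
          A *v ?z p s - K *v (C *v (\<Sum>q<d. Hhat N r a $$ (p, q) *\<^sub>R ?z q s)) - K *v Finite_Cartesian_Product.vec (w p)) (at s within {0..})"
        using compensator_error_equation[OF lead comp i s] ik
          Hhat_row[of p N r i k a "\<lambda>x. etabar x0 \<eta> (fst x) (snd x) s"] p ai
        by (cases "k \<le> r i") (simp_all add: w_def ix_def d_def)
    qed
    from Vder[OF this] obtain D where D: "(v x0 \<eta> has_real_derivative D) (at s within {0..})"
      "D \<le> - \<kappa> * v x0 \<eta> s + c3 * (\<Sum>p<d. (w p)\<^sup>2)" by (auto simp: v_def[abs_def])
    have "(\<Sum>p<d. (w p)\<^sup>2) \<le> W * L\<^sup>2" unfolding W_def sum_distrib_right using wle by (intro sum_mono) auto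
    then have "c3 * (\<Sum>p<d. (w p)\<^sup>2) \<le> cW * L\<^sup>2" using c3 by (simp add: cW_def mult.assoc)
    then show ?thesis using D unfolding L_def by (meson add_left_mono order_trans)
  qed
  have v0: "0 \<le> v x0 \<eta> t" for x0 \<eta> t using V0 by (simp add: v_def)
  show ?thesis
  \<comment> \<open>taking square roots halves the rate; adding \<open>1\<close> makes \<open>\<gamma>\<close> strictly increasing even if the input gain vanishes\<close>
  proof (intro conjI exI[of _ "\<lambda>s t. sqrt (c1 * c2) * exp (- (\<kappa> / 2) * t) * s"]
      exI[of _ "\<lambda>s. (sqrt (c1 * cW / \<kappa>) + 1) * s"] allI impI ballI)
    show "class_KL (\<lambda>s t. sqrt (c1 * c2) * exp (- (\<kappa> / 2) * t) * s)"
      using c1 c2 \<kappa> by (intro class_KL_exponential) auto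
    have "0 \<le> sqrt (c1 * cW / \<kappa>)" using c1 cW0 \<kappa> by simp
    then show "class_K (\<lambda>s. (sqrt (c1 * cW / \<kappa>) + 1) * s)" by (intro class_K_linear) linarith
  next
    fix u x x0 \<eta> i l and t :: real
    assume sol: "follower_solution N r m \<psi> \<theta> u x \<and> leader_solution A x0 \<and>
           compensator_solution N r a A C K (outp C x0 x) \<eta> \<and> Linf_norm N (ehat C x \<eta>) < \<infinity>"
      and il: "i \<in> {1..N}" "l \<in> {1..r i + 1}" and t: "0 \<le> t"
    define L where "L = real_of_ereal (Linf_norm N (ehat C x \<eta>))"
    define n0 where "n0 = stacked_norm N r (\<lambda>i l. etabar x0 \<eta> i l 0)"
    have n0: "0 \<le> n0" by (simp add: n0_def stacked_norm_def)
    have LL: "L2_set (\<lambda>i. ehat C x \<eta> i s) {1..N} \<le> L" if "0 \<le> s" for s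
      unfolding L_def using sol that by (intro ehat_norm_le_Linf_norm[OF assms(2)]) auto
    have L0: "0 \<le> L" using LL[of 0] by (meson L2_set_nonneg order_refl order_trans)
    have "\<exists>D. (v x0 \<eta> has_real_derivative D) (at s within {0..}) \<and> D \<le> - \<kappa> * v x0 \<eta> s + cW * L\<^sup>2" if s: "0 \<le> s" for s
    proof -
      have "cW * (L2_set (\<lambda>i. ehat C x \<eta> i s) {1..N})\<^sup>2 \<le> cW * L\<^sup>2"
        using LL[OF s] cW0 by (intro mult_left_mono power_mono) auto
      then show ?thesis using vder[of x0 x \<eta> s] sol s by (meson add_left_mono order_trans)
    qed
    from exponential_comparison[OF \<kappa> _ t this]
    have "v x0 \<eta> t \<le> exp (- \<kappa> * t) * v x0 \<eta> 0 + cW * L\<^sup>2 / \<kappa>" using cW0 by simp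
    also have "\<dots> \<le> exp (- \<kappa> * t) * (c2 * n0\<^sup>2) + cW * L\<^sup>2 / \<kappa>"
      using vup[of x0 \<eta> 0] by (simp add: n0_def)
    finally have "c1 * v x0 \<eta> t \<le> c1 * (exp (- \<kappa> * t) * (c2 * n0\<^sup>2) + cW * L\<^sup>2 / \<kappa>)" using c1 by simp
    then have "(norm (etabar x0 \<eta> i l t))\<^sup>2 \<le> c1 * (exp (- \<kappa> * t) * (c2 * n0\<^sup>2) + cW * L\<^sup>2 / \<kappa>)"
      using vlow[OF il, of x0 \<eta> t] by linarith
    also have "\<dots> = (sqrt (c1 * c2) * exp (- (\<kappa> / 2) * t) * n0)\<^sup>2 + (sqrt (c1 * cW / \<kappa>) * L)\<^sup>2"
    proof -
      have "exp (- \<kappa> * t) = (exp (- (\<kappa> / 2) * t))\<^sup>2" by (simp flip: exp_double)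
      then show ?thesis using c1 c2 cW0 \<kappa> by (simp add: power_mult_distrib algebra_simps)
    qed
    also have "\<dots> \<le> (sqrt (c1 * c2) * exp (- (\<kappa> / 2) * t) * n0 + sqrt (c1 * cW / \<kappa>) * L)\<^sup>2"
    proof -
      have "0 \<le> 2 * (sqrt (c1 * c2) * exp (- (\<kappa> / 2) * t) * n0) * (sqrt (c1 * cW / \<kappa>) * L)"
        using c1 c2 cW0 \<kappa> n0 L0 by simp
      then show ?thesis by (simp only: power2_sum)
    qed
    finally have "norm (etabar x0 \<eta> i l t) \<le> sqrt (c1 * c2) * exp (- (\<kappa> / 2) * t) * n0 + sqrt (c1 * cW / \<kappa>) * L"
      by (rule power2_le_imp_le) (use c1 c2 cW0 \<kappa> n0 L0 in simp)
    then show "norm (etabar x0 \<eta> i l t) \<le> sqrt (c1 * c2) * exp (- (\<kappa> / 2) * t) * stacked_norm N r (\<lambda>i l. etabar x0 \<eta> i l 0)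
        + (sqrt (c1 * cW / \<kappa>) + 1) * real_of_ereal (Linf_norm N (ehat C x \<eta>))"
      using L0 by (simp add: n0_def L_def algebra_simps)
  next
    fix u x x0 \<eta> i l
    assume sol: "follower_solution N r m \<psi> \<theta> u x \<and> leader_solution A x0 \<and>
           compensator_solution N r a A C K (outp C x0 x) \<eta> \<and> (\<forall>i\<in>{1..N}. (ehat C x \<eta> i \<longlongrightarrow> 0) at_top)"
      and il: "i \<in> {1..N}" "l \<in> {1..r i + 1}"
    have "((\<lambda>s. L2_set (\<lambda>i. ehat C x \<eta> i s) {1..N}) \<longlongrightarrow> sqrt (\<Sum>i=1..N. 0\<^sup>2)) at_top"
      unfolding L2_set_def using sol by (intro tendsto_intros) auto
    then have "((\<lambda>s. cW * (L2_set (\<lambda>i. ehat C x \<eta> i s) {1..N})\<^sup>2) \<longlongrightarrow> cW * 0\<^sup>2) at_top"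
      by (intro tendsto_intros) simp
    then have b: "((\<lambda>s. cW * (L2_set (\<lambda>i. ehat C x \<eta> i s) {1..N})\<^sup>2) \<longlongrightarrow> 0) at_top" by simp
    have "(v x0 \<eta> \<longlongrightarrow> 0) at_top"
    proof (rule vanishing_input_imp_vanishing_storage[OF \<kappa> v0 b])
      show "\<exists>D. (v x0 \<eta> has_real_derivative D) (at s within {0..}) \<and>
          D \<le> - \<kappa> * v x0 \<eta> s + cW * (L2_set (\<lambda>i. ehat C x \<eta> i s) {1..N})\<^sup>2" if "0 \<le> s" for s
        by (rule vder) (use sol that in blast)+
    qed
    then have "((\<lambda>t. c1 * v x0 \<eta> t) \<longlongrightarrow> c1 * 0) at_top" by (intro tendsto_intros)
    then have c: "((\<lambda>t. c1 * v x0 \<eta> t) \<longlongrightarrow> 0) at_top" by simp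
    have "((\<lambda>t. (norm (etabar x0 \<eta> i l t))\<^sup>2) \<longlongrightarrow> 0) at_top"
      by (rule tendsto_sandwich[OF _ _ tendsto_const c]) (use vlow[OF il] in simp_all)
    then have "((\<lambda>t. sqrt ((norm (etabar x0 \<eta> i l t))\<^sup>2)) \<longlongrightarrow> sqrt 0) at_top" by (intro tendsto_intros)
    then show "(etabar x0 \<eta> i l \<longlongrightarrow> 0) at_top" by (simp add: tendsto_norm_zero_iff)
  qed
qed

end
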